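(* Let $A$ be a triassociative algebra over a field $K$, and regard its universal enveloping algebra $UA$ as an $A$-corepresentation via right multiplication. Then $(C_*^{\mathrm{Trias}}(A,UA),d)$ is a chain complex.
   Context: All vector spaces and tensor products are over a fixed field $K$. A triassociative algebra is a vector space $A$ with three bilinear operations $\dashv,\vdash,\bot$ satisfying for all $x,y,z$: (1) $(x\dashv y)\dashv z=x\dashv(y\dashv z)$; (2) $(x\dashv y)\dashv z=x\dashv(y\vdash z)$; (3) $(x\vdash y)\dashv z=x\vdash(y\dashv z)$; (4) $(x\dashv y)\vdash z=x\vdash(y\vdash z)$; (5) $(x\vdash y)\vdash z=x\vdash(y\vdash z)$; (6) $(x\dashv y)\dashv z=x\dashv(y\,\bot\, z)$; (7) $(x\,\bot\, y)\dashv z=x\,\bot\,(y\dashv z)$; (8) $(x\dashv y)\,\bot\, z=x\,\bot\,(y\vdash z)$; (9) $(x\vdash y)\,\bot\, z=x\vdash(y\,\bot\, z)$; (10) $(x\,\bot\, y)\vdash z=x\vdash(y\vdash z)$; (11) $(x\,\bot\, y)\,\bot\, z=x\,\bot\,(y\,\bot\, z)$. The universal enveloping algebra $UA$ is the unital associative $K$-algebra obtained from the tensor algebra $T(\alpha_lA\oplus\alpha_rA\oplus\alpha_mA\oplus\beta_lA\oplus\beta_rA\oplus\beta_mA)$ on six copies of $A$ (with elements written $\alpha_l(a)$, etc.) by imposing the following $33$ relations for all $a,b\in A$: (1)-(3) $\beta_l(b)\beta_l(a)=\beta_l(a\dashv b)=\beta_l(a\,\bot\,b)=\beta_l(a\vdash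 b)$; (4)-(6) $\beta_l(b)\alpha_l(a)=\alpha_l(a)\beta_l(b)=\alpha_l(a)\beta_m(b)=\alpha_l(a)\beta_r(b)$; (7)-(9) $\alpha_l(a\dashv b)=\alpha_l(a)\alpha_l(b)=\alpha_l(a)\alpha_m(b)=\alpha_l(a)\alpha_r(b)$; (10)-(12) $\beta_r(a\vdash b)=\beta_r(b)\beta_r(a)=\beta_r(b)\beta_l(a)=\beta_r(b)\beta_m(a)$; (13)-(15) $\alpha_r(a)\beta_r(b)=\beta_r(b)\alpha_r(a)=\beta_r(b)\alpha_l(a)=\beta_r(b)\alpha_m(a)$; (16)-(18) $\alpha_r(a)\alpha_r(b)=\alpha_r(a\vdash b)=\alpha_r(a\dashv b)=\alpha_r(a\,\bot\,b)$; (19) $\beta_l(b)\beta_r(a)=\beta_r(a\dashv b)$; (20) $\beta_l(b)\alpha_r(a)=\alpha_r(a)\beta_l(b)$; (21) $\alpha_l(a\vdash b)=\alpha_r(a)\alpha_l(b)$; (22) $\beta_l(b)\beta_m(a)=\beta_m(a\dashv b)$; (23) $\beta_l(b)\alpha_m(a)=\alpha_m(a)\beta_l(b)$; (24) $\alpha_l(a\,\bot\,b)=\alpha_m(a)\alpha_l(b)$; (25) $\beta_m(b)\beta_l(a)=\beta_m(a\vdash b)$; (26) $\beta_m(b)\alpha_l(a)=\alpha_m(a)\beta_r(b)$; (27) $\alpha_m(a\dashv b)=\alpha_m(a)\alpha_r(b)$; (28) $\beta_m(b)\beta_r(a)=\beta_r(a\,\bot\,b)$; (29) $\beta_m(b)\alpha_r(a)=\alpha_r(a)\beta_m(b)$;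 (30) $\alpha_m(a\vdash b)=\alpha_r(a)\alpha_m(b)$; (31) $\beta_m(b)\beta_m(a)=\beta_m(a\,\bot\,b)$; (32) $\beta_m(b)\alpha_m(a)=\alpha_m(a)\beta_m(b)$; (33) $\alpha_m(a\,\bot\,b)=\alpha_m(a)\alpha_m(b)$. An $A$-corepresentation is a right $UA$-module. Trees. $T_n$ ($n\ge0$) is the set of planar rooted trees with $n+1$ leaves in which every internal vertex has at least $2$ incoming edges ($T_0=\{|\}$, no internal vertex); $\psi\in T_n$ has degree $|\psi|=n$; leaves are numbered $0,\dots,n$ from left to right. The grafting $\psi_0\vee\cdots\vee\psi_k$ is obtained by arranging the trees from left to right and joining their roots to a new lowest internal vertex, connected to a new root; every tree of degree $\ge1$ is uniquely of this form with $k\ge1$. A leaf is left (resp. right) oriented if it is the leftmost (resp. rightmost) incoming edge of the vertex it is attached to; otherwise it is a middle leaf. For $\psi\in T_n$, $d_i\psi\in T_{n-1}$ ($0\le i\le n$) is obtained by deleting the $i$th leaf (suppressing any vertex left with one incoming edge). For $\psi\in T_n$ and $1\le i\le n-1$, $\circ_i^\psi$ is $\dashv$, $\vdash$, or $\bot$ according as the $i$th leaf of $\psi$ is left oriented, right oriented, or a middle leaf. Chains. For an $A$-corepresentation $N$, $C_n^{\mathrm{Trias}}(A,N)=K[T_n]\otimes N\otimes A^{\otimes n}$ ($n\ge0$), and $d=\sum_{i=0}^n(-1)^id_i\colon C_n^{\mathrm{Trias}}(A,N)\to C_{n-1}^{\mathrm{Trias}}(A,N)$ for $n\ge1$, where $d_i(\psi\otimes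 x\otimes\mathbf a)=(d_i\psi)\otimes d_i^\psi(x\otimes\mathbf a)$ for $\psi=\psi_0\vee\cdots\vee\psi_k\in T_n$, $x\in N$, $\mathbf a=(a_1,\dots,a_n)\in A^{\otimes n}$, and: $d_0^\psi(x\otimes\mathbf a)=(x\cdot\gamma)\otimes(a_2,\dots,a_n)$ with $\gamma=\alpha_l(a_1)$ if $|\psi_0|=0$ and $k=1$; $\gamma=\alpha_m(a_1)$ if $|\psi_0|=0$ and $k>1$; $\gamma=\alpha_r(a_1)$ if $|\psi_0|>0$; $d_i^\psi(x\otimes\mathbf a)=x\otimes(a_1,\dots,a_i\circ_i^\psi a_{i+1},\dots,a_n)$ for $1\le i\le n-1$; $d_n^\psi(x\otimes\mathbf a)=(x\cdot\gamma)\otimes(a_1,\dots,a_{n-1})$ with $\gamma=\beta_l(a_n)$ if $|\psi_k|>0$; $\gamma=\beta_m(a_n)$ if $k>1$ and $|\psi_k|=0$; $\gamma=\beta_r(a_n)$ if $k=1$ and $|\psi_1|=0$. *)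

theory Defs
  imports "HOL-Algebra.Algebraic_Closure_Type" "HOL-Library.Poly_Mapping"
begin

section \<open>Triassociative algebras\<close>

locale triassociative_algebra = vector_space scale
  for scale :: "'k::field \<Rightarrow> 'a::ab_group_add \<Rightarrow> 'a" +
  fixes left :: "'a \<Rightarrow> 'a \<Rightarrow> 'a" (infixl \<open>\<stileturn>\<close> 70)
    and right :: "'a \<Rightarrow> 'a \<Rightarrow> 'a" (infixl \<open>\<turnstile>\<close> 70)
    and mid :: "'a \<Rightarrow> 'a \<Rightarrow> 'a" (infixl \<open>\<bottom>\<close> 70)
  assumes linear_left: "Vector_Spaces.linear scale scale (\<lambda>x. x \<stileturn> y)"
      "Vector_Spaces.linear scale scale (\<lambda>y. x \<stileturn> y)"
    and linear_right: "Vector_Spaces.linear scale scale (\<lambda>x. x \<turnstile> y)"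
      "Vector_Spaces.linear scale scale (\<lambda>y. x \<turnstile> y)"
    and linear_mid: "Vector_Spaces.linear scale scale (\<lambda>x. x \<bottom> y)"
      "Vector_Spaces.linear scale scale (\<lambda>y. x \<bottom> y)"
    and trias1: "(x \<stileturn> y) \<stileturn> z = x \<stileturn> (y \<stileturn> z)"
    and trias2: "(x \<stileturn> y) \<stileturn> z = x \<stileturn> (y \<turnstile> z)"
    and trias3: "(x \<turnstile> y) \<stileturn> z = x \<turnstile> (y \<stileturn> z)"
    and trias4: "(x \<stileturn> y) \<turnstile> z = x \<turnstile> (y \<turnstile> z)"
    and trias5: "(x \<turnstile> y) \<turnstile> z = x \<turnstile> (y \<turnstile> z)"
    and trias6: "(x \<stileturn> y) \<stileturn> z = x \<stileturn> (y \<bottom> z)"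
    and trias7: "(x \<bottom> y) \<stileturn> z = x \<bottom> (y \<stileturn> z)"
    and trias8: "(x \<stileturn> y) \<bottom> z = x \<bottom> (y \<turnstile> z)"
    and trias9: "(x \<turnstile> y) \<bottom> z = x \<turnstile> (y \<bottom> z)"
    and trias10: "(x \<bottom> y) \<turnstile> z = x \<turnstile> (y \<turnstile> z)"
    and trias11: "(x \<bottom> y) \<bottom> z = x \<bottom> (y \<bottom> z)"


section \<open>Free modules and quotient modules\<close>

text \<open>The multiplicative fields of a module record are irrelevant, hence left undefined.\<close>

definition pm_scale :: "'k::comm_ring_1 \<Rightarrow> ('x \<Rightarrow>\<^sub>0 'k) \<Rightarrow> ('x \<Rightarrow>\<^sub>0 'k)" where
  "pm_scale c = Poly_Mapping.map ((*) c)"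

definition free_module :: "'x set \<Rightarrow> ('k::comm_ring_1, 'x \<Rightarrow>\<^sub>0 'k) module" where
  "free_module B = \<lparr>carrier = {p. Poly_Mapping.keys p \<subseteq> B}, monoid.mult = undefined, one = undefined,
     zero = 0, add = (+), module.smult = pm_scale\<rparr>"

definition linear_extension :: "('x \<Rightarrow> 'y) \<Rightarrow> ('x \<Rightarrow>\<^sub>0 'k::comm_ring_1) \<Rightarrow> ('y \<Rightarrow>\<^sub>0 'k)" where
  "linear_extension f p =
     (\<Sum>b\<in>Poly_Mapping.keys p. Poly_Mapping.single (f b) (Poly_Mapping.lookup p b))"

definition generated_submodule ::
    "('k, 'r) ring_scheme \<Rightarrow> ('k, 'm, 's) module_scheme \<Rightarrow> 'm set \<Rightarrow> 'm set" where
  "generated_submodule R M S = \<Inter>{H. submodule H R M \<and> S \<subseteq> H}"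

definition quotient_module ::
    "('k, 'm, 's) module_scheme \<Rightarrow> 'm set \<Rightarrow> ('k, 'm set) module" where
  "quotient_module M U = \<lparr>carrier = a_rcosets\<^bsub>M\<^esub> U, monoid.mult = undefined, one = undefined,
     zero = U, add = set_add M, module.smult = (\<lambda>c Y. \<Union>y\<in>Y. U +>\<^bsub>M\<^esub> (c \<odot>\<^bsub>M\<^esub> y))\<rparr>"


section \<open>Tensor algebras\<close>

datatype 'v free_monoid = Word (letters: "'v list")

instantiation free_monoid :: (type) monoid_add
begin

definition zero_free_monoid :: "'a free_monoid" where
  "0 = Word []"

definition plus_free_monoid :: "'a free_monoid \<Rightarrow> 'a free_monoid \<Rightarrow> 'a free_monoid" where
  "v + w = Word (letters v @ letters w)"

instance
  by standard (simp_all add: zero_free_monoid_def plus_free_monoid_def)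

end

text \<open>
  With convolution as multiplication, \<^typ>\<open>'v free_monoid \<Rightarrow>\<^sub>0 'k\<close> is the free unital
  associative algebra over \<open>'k\<close> on the underlying set of \<open>'v\<close>. The tensor algebra of the vector
  space \<open>'v\<close> is its quotient by the linear relations between the letters.
\<close>

definition letter :: "'v \<Rightarrow> ('v free_monoid \<Rightarrow>\<^sub>0 'k::field)" where
  "letter v = Poly_Mapping.single (Word [v]) 1"

definition tensor_ideal ::
    "('k::field \<Rightarrow> 'v::ab_group_add \<Rightarrow> 'v) \<Rightarrow> ('v free_monoid \<Rightarrow>\<^sub>0 'k) set" where
  "tensor_ideal sc = Idl\<^bsub>ring_of_type_algebra\<^esub>
     ({letter (u + v) - (letter u + letter v) | u v. True} \<union>
      {letter (sc c v) - pm_scale c (letter v) | c v. True})"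

definition tensor_algebra ::
    "('k::field \<Rightarrow> 'v::ab_group_add \<Rightarrow> 'v) \<Rightarrow> ('v free_monoid \<Rightarrow>\<^sub>0 'k) set ring" where
  "tensor_algebra sc = ring_of_type_algebra Quot tensor_ideal sc"

definition tensor_class ::
    "('k::field \<Rightarrow> 'v::ab_group_add \<Rightarrow> 'v) \<Rightarrow> ('v free_monoid \<Rightarrow>\<^sub>0 'k) \<Rightarrow>
     ('v free_monoid \<Rightarrow>\<^sub>0 'k) set" where
  "tensor_class sc p = tensor_ideal sc +>\<^bsub>ring_of_type_algebra\<^esub> p"


section \<open>The universal enveloping algebra\<close>

datatype env_index = Alpha_l | Alpha_r | Alpha_m | Beta_l | Beta_r | Beta_m

text \<open>\<^typ>\<open>env_index \<Rightarrow>\<^sub>0 'a\<close> is the direct sum of six copies of \<open>'a\<close>.\<close>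

type_synonym ('a, 'k) tensor_elem = "((env_index \<Rightarrow>\<^sub>0 'a) free_monoid \<Rightarrow>\<^sub>0 'k) set"
type_synonym ('a, 'k) env_elem = "('a, 'k) tensor_elem set"

context triassociative_algebra
begin

definition sum_scale :: "'k \<Rightarrow> (env_index \<Rightarrow>\<^sub>0 'a) \<Rightarrow> (env_index \<Rightarrow>\<^sub>0 'a)" where
  "sum_scale c = Poly_Mapping.map (scale c)"

definition TA :: "('a, 'k) tensor_elem ring" where
  "TA = tensor_algebra sum_scale"

definition tensor_gen :: "env_index \<Rightarrow> 'a \<Rightarrow> ('a, 'k) tensor_elem" where
  "tensor_gen g a = tensor_class sum_scale (letter (Poly_Mapping.single g a))"

abbreviation \<alpha>\<^sub>l where "\<alpha>\<^sub>l \<equiv> tensor_gen Alpha_l"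
abbreviation \<alpha>\<^sub>r where "\<alpha>\<^sub>r \<equiv> tensor_gen Alpha_r"
abbreviation \<alpha>\<^sub>m where "\<alpha>\<^sub>m \<equiv> tensor_gen Alpha_m"
abbreviation \<beta>\<^sub>l where "\<beta>\<^sub>l \<equiv> tensor_gen Beta_l"
abbreviation \<beta>\<^sub>r where "\<beta>\<^sub>r \<equiv> tensor_gen Beta_r"
abbreviation \<beta>\<^sub>m where "\<beta>\<^sub>m \<equiv> tensor_gen Beta_m"
abbreviation tensor_mult (infixl \<open>\<star>\<close> 70) where "p \<star> q \<equiv> p \<otimes>\<^bsub>TA\<^esub> q"

text \<open>A pair \<open>(p, q)\<close> stands for the relation \<open>p = q\<close>.\<close>

definition env_relations :: "'a \<Rightarrow> 'a \<Rightarrow> (('a, 'k) tensor_elem \<times> ('a, 'k) tensor_elem) set" where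
  "env_relations a b =
    {(\<beta>\<^sub>l b \<star> \<beta>\<^sub>l a, \<beta>\<^sub>l (a \<stileturn> b)), (\<beta>\<^sub>l b \<star> \<beta>\<^sub>l a, \<beta>\<^sub>l (a \<bottom> b)), (\<beta>\<^sub>l b \<star> \<beta>\<^sub>l a, \<beta>\<^sub>l (a \<turnstile> b)),
     (\<beta>\<^sub>l b \<star> \<alpha>\<^sub>l a, \<alpha>\<^sub>l a \<star> \<beta>\<^sub>l b), (\<beta>\<^sub>l b \<star> \<alpha>\<^sub>l a, \<alpha>\<^sub>l a \<star> \<beta>\<^sub>m b), (\<beta>\<^sub>l b \<star> \<alpha>\<^sub>l a, \<alpha>\<^sub>l a \<star> \<beta>\<^sub>r b),
     (\<alpha>\<^sub>l (a \<stileturn> b), \<alpha>\<^sub>l a \<star> \<alpha>\<^sub>l b), (\<alpha>\<^sub>l (a \<stileturn> b), \<alpha>\<^sub>l a \<star> \<alpha>\<^sub>m b), (\<alpha>\<^sub>l (a \<stileturn> b), \<alpha>\<^sub>l a \<star> \<alpha>\<^sub>r b),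
     (\<beta>\<^sub>r (a \<turnstile> b), \<beta>\<^sub>r b \<star> \<beta>\<^sub>r a), (\<beta>\<^sub>r (a \<turnstile> b), \<beta>\<^sub>r b \<star> \<beta>\<^sub>l a), (\<beta>\<^sub>r (a \<turnstile> b), \<beta>\<^sub>r b \<star> \<beta>\<^sub>m a),
     (\<alpha>\<^sub>r a \<star> \<beta>\<^sub>r b, \<beta>\<^sub>r b \<star> \<alpha>\<^sub>r a), (\<alpha>\<^sub>r a \<star> \<beta>\<^sub>r b, \<beta>\<^sub>r b \<star> \<alpha>\<^sub>l a), (\<alpha>\<^sub>r a \<star> \<beta>\<^sub>r b, \<beta>\<^sub>r b \<star> \<alpha>\<^sub>m a),
     (\<alpha>\<^sub>r a \<star> \<alpha>\<^sub>r b, \<alpha>\<^sub>r (a \<turnstile> b)), (\<alpha>\<^sub>r a \<star> \<alpha>\<^sub>r b, \<alpha>\<^sub>r (a \<stileturn> b)), (\<alpha>\<^sub>r a \<star> \<alpha>\<^sub>r b, \<alpha>\<^sub>r (a \<bottom> b)),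
     (\<beta>\<^sub>l b \<star> \<beta>\<^sub>r a, \<beta>\<^sub>r (a \<stileturn> b)), (\<beta>\<^sub>l b \<star> \<alpha>\<^sub>r a, \<alpha>\<^sub>r a \<star> \<beta>\<^sub>l b), (\<alpha>\<^sub>l (a \<turnstile> b), \<alpha>\<^sub>r a \<star> \<alpha>\<^sub>l b),
     (\<beta>\<^sub>l b \<star> \<beta>\<^sub>m a, \<beta>\<^sub>m (a \<stileturn> b)), (\<beta>\<^sub>l b \<star> \<alpha>\<^sub>m a, \<alpha>\<^sub>m a \<star> \<beta>\<^sub>l b), (\<alpha>\<^sub>l (a \<bottom> b), \<alpha>\<^sub>m a \<star> \<alpha>\<^sub>l b),
     (\<beta>\<^sub>m b \<star> \<beta>\<^sub>l a, \<beta>\<^sub>m (a \<turnstile> b)), (\<beta>\<^sub>m b \<star> \<alpha>\<^sub>l a, \<alpha>\<^sub>m a \<star> \<beta>\<^sub>r b), (\<alpha>\<^sub>m (a \<stileturn> b), \<alpha>\<^sub>m a \<star> \<alpha>\<^sub>r b),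
     (\<beta>\<^sub>m b \<star> \<beta>\<^sub>r a, \<beta>\<^sub>r (a \<bottom> b)), (\<beta>\<^sub>m b \<star> \<alpha>\<^sub>r a, \<alpha>\<^sub>r a \<star> \<beta>\<^sub>m b), (\<alpha>\<^sub>m (a \<turnstile> b), \<alpha>\<^sub>r a \<star> \<alpha>\<^sub>m b),
     (\<beta>\<^sub>m b \<star> \<beta>\<^sub>m a, \<beta>\<^sub>m (a \<bottom> b)), (\<beta>\<^sub>m b \<star> \<alpha>\<^sub>m a, \<alpha>\<^sub>m a \<star> \<beta>\<^sub>m b), (\<alpha>\<^sub>m (a \<bottom> b), \<alpha>\<^sub>m a \<star> \<alpha>\<^sub>m b)}"

definition env_ideal :: "('a, 'k) tensor_elem set" where
  "env_ideal = Idl\<^bsub>TA\<^esub> {p \<ominus>\<^bsub>TA\<^esub> q | p q. \<exists>a b. (p, q) \<in> env_relations a b}"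

definition UA :: "('a, 'k) env_elem ring" where
  "UA = TA Quot env_ideal"

definition env_gen :: "env_index \<Rightarrow> 'a \<Rightarrow> ('a, 'k) env_elem" where
  "env_gen g a = env_ideal +>\<^bsub>TA\<^esub> tensor_gen g a"

text \<open>The structure map from the ground field to \<open>UA\<close>.\<close>

definition env_scalar :: "'k \<Rightarrow> ('a, 'k) env_elem" where
  "env_scalar c = env_ideal +>\<^bsub>TA\<^esub> tensor_class sum_scale (Poly_Mapping.single 0 c)"

end


section \<open>Corepresentations\<close>

locale right_module = R?: ring R + M?: abelian_group M
  for R :: "('r, 'p) ring_scheme" (structure) and M :: "('m, 'q) ring_scheme" (structure) +
  fixes act :: "'m \<Rightarrow> 'r \<Rightarrow> 'm" (infixl \<open>\<cdot>\<close> 70)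
  assumes act_closed: "\<lbrakk>x \<in> carrier M; r \<in> carrier R\<rbrakk> \<Longrightarrow> x \<cdot> r \<in> carrier M"
    and act_add_left: "\<lbrakk>x \<in> carrier M; y \<in> carrier M; r \<in> carrier R\<rbrakk> \<Longrightarrow>
      (x \<oplus>\<^bsub>M\<^esub> y) \<cdot> r = x \<cdot> r \<oplus>\<^bsub>M\<^esub> y \<cdot> r"
    and act_add_right: "\<lbrakk>x \<in> carrier M; r \<in> carrier R; s \<in> carrier R\<rbrakk> \<Longrightarrow>
      x \<cdot> (r \<oplus> s) = x \<cdot> r \<oplus>\<^bsub>M\<^esub> x \<cdot> s"
    and act_mult: "\<lbrakk>x \<in> carrier M; r \<in> carrier R; s \<in> carrier R\<rbrakk> \<Longrightarrow>
      x \<cdot> (r \<otimes> s) = (x \<cdot> r) \<cdot> s"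
    and act_one: "x \<in> carrier M \<Longrightarrow> x \<cdot> \<one> = x"

lemma (in ring) regular_right_module: "right_module R R (monoid.mult R)"
  by unfold_locales (auto simp: l_distr r_distr m_assoc)

lemma ring_ring_of_type_algebra: "ring (ring_of_type_algebra :: 'a::ring_1 ring)"
proof -
  have "\<exists>y. y + x = 0 \<and> x + y = 0" for x :: 'a
    by (rule exI[of _ "- x"]) simp
  then show ?thesis
    unfolding ring_of_type_algebra_def
    by unfold_locales (auto simp: algebra_simps Units_def)
qed

lemma ring_tensor_algebra:
  fixes sc :: "'k::field \<Rightarrow> 'v::ab_group_add \<Rightarrow> 'v"
  shows "ring (tensor_algebra sc)"
proof -
  interpret R: ring "ring_of_type_algebra :: ('v free_monoid \<Rightarrow>\<^sub>0 'k::field) ring"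
    by (rule ring_ring_of_type_algebra)
  have "ideal (tensor_ideal sc) ring_of_type_algebra"
    unfolding tensor_ideal_def
    by (rule R.genideal_ideal) (simp add: ring_of_type_algebra_def)
  then show ?thesis
    unfolding tensor_algebra_def by (rule ideal.quotient_is_ring)
qed

context triassociative_algebra
begin

lemma tensor_gen_closed: "tensor_gen g a \<in> carrier TA"
  by (auto simp: tensor_gen_def tensor_class_def TA_def tensor_algebra_def FactRing_def
      A_RCOSETS_def' a_r_coset_def' ring_of_type_algebra_def)

lemma ring_UA: "ring UA"
proof -
  interpret T: ring TA
    unfolding TA_def by (rule ring_tensor_algebra)
  have "p \<in> carrier TA \<and> q \<in> carrier TA" if "(p, q) \<in> env_relations a b" for p q a b
    using that by (auto simp: env_relations_def intro!: tensor_gen_closed)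
  then have "ideal env_ideal TA"
    unfolding env_ideal_def by (intro T.genideal_ideal) auto
  then show ?thesis
    unfolding UA_def by (rule ideal.quotient_is_ring)
qed

abbreviation corepresentation where
  "corepresentation N act \<equiv> right_module UA N act"

lemma corepresentation_UA: "corepresentation UA (monoid.mult UA)"
  by (rule ring.regular_right_module[OF ring_UA])

end


section \<open>Planar trees\<close>

datatype ptree = Leaf | Node "ptree list"

fun leaves :: "ptree \<Rightarrow> nat" where
  "leaves Leaf = 1"
| "leaves (Node ts) = (\<Sum>t\<leftarrow>ts. leaves t)"

fun reduced :: "ptree \<Rightarrow> bool" where
  "reduced Leaf \<longleftrightarrow> True"
| "reduced (Node ts) \<longleftrightarrow> length ts \<ge> 2 \<and> (\<forall>t\<in>set ts. reduced t)"

definition trees :: "nat \<Rightarrow> ptree set" where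
  "trees n = {\<psi>. reduced \<psi> \<and> leaves \<psi> = n + 1}"

definition tree_degree :: "ptree \<Rightarrow> nat" where
  "tree_degree \<psi> = leaves \<psi> - 1"

text \<open>Deletion of the \<open>i\<close>-th leaf, on trees and on forests; a root vertex left with a single
  incoming edge is suppressed. The value on \<^const>\<open>Leaf\<close> is a dummy.\<close>

fun delete_leaf :: "nat \<Rightarrow> ptree \<Rightarrow> ptree"
  and delete_leaf_forest :: "nat \<Rightarrow> ptree list \<Rightarrow> ptree list" where
  "delete_leaf i Leaf = Leaf"
| "delete_leaf i (Node ts) = (case delete_leaf_forest i ts of [t] \<Rightarrow> t | us \<Rightarrow> Node us)"
| "delete_leaf_forest i [] = []"
| "delete_leaf_forest i (t # ts) =
     (if i < leaves t then (if t = Leaf then ts else delete_leaf i t # ts)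
      else t # delete_leaf_forest (i - leaves t) ts)"

datatype orientation = Left_oriented | Right_oriented | Middle

text \<open>The flag of \<open>orient_forest\<close> records whether the head of the list is the leftmost
  incoming edge of its vertex.\<close>

fun orient :: "nat \<Rightarrow> ptree \<Rightarrow> orientation"
  and orient_forest :: "bool \<Rightarrow> nat \<Rightarrow> ptree list \<Rightarrow> orientation" where
  "orient i Leaf = undefined"
| "orient i (Node ts) = orient_forest True i ts"
| "orient_forest leftmost i [] = undefined"
| "orient_forest leftmost i (t # ts) =
     (if i < leaves t then
        (if t = Leaf then
           (if leftmost then Left_oriented else if ts = [] then Right_oriented else Middle)
         else orient i t)
      else orient_forest False (i - leaves t) ts)"

text \<open>For \<open>\<psi> = Node [\<psi>\<^sub>0, \<dots>, \<psi>\<^sub>k]\<close>, the condition \<open>k = 1\<close> reads \<open>length ts = 2\<close>.\<close>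

fun first_index :: "ptree \<Rightarrow> env_index" where
  "first_index (Node ts) =
     (if tree_degree (hd ts) > 0 then Alpha_r
      else if length ts = 2 then Alpha_l else Alpha_m)"
| "first_index Leaf = undefined"

fun last_index :: "ptree \<Rightarrow> env_index" where
  "last_index (Node ts) =
     (if tree_degree (last ts) > 0 then Beta_l
      else if length ts = 2 then Beta_r else Beta_m)"
| "last_index Leaf = undefined"


section \<open>The complex with coefficients\<close>

locale chain_complex =
  fixes R :: "('k, 'r) ring_scheme"
    and C :: "nat \<Rightarrow> ('k, 'c, 's) module_scheme"
    and d :: "nat \<Rightarrow> 'c \<Rightarrow> 'c"
  assumes module_C: "Module.module R (C n)"
    and d_closed: "\<lbrakk>n \<ge> 1; x \<in> carrier (C n)\<rbrakk> \<Longrightarrow> d n x \<in> carrier (C (n - 1))"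
    and d_add: "\<lbrakk>n \<ge> 1; x \<in> carrier (C n); y \<in> carrier (C n)\<rbrakk> \<Longrightarrow>
      d n (x \<oplus>\<^bsub>C n\<^esub> y) = d n x \<oplus>\<^bsub>C (n - 1)\<^esub> d n y"
    and d_smult: "\<lbrakk>n \<ge> 1; c \<in> carrier R; x \<in> carrier (C n)\<rbrakk> \<Longrightarrow>
      d n (c \<odot>\<^bsub>C n\<^esub> x) = c \<odot>\<^bsub>C (n - 1)\<^esub> d n x"
    and d_d: "\<lbrakk>n \<ge> 2; x \<in> carrier (C n)\<rbrakk> \<Longrightarrow> d (n - 1) (d n x) = \<zero>\<^bsub>C (n - 2)\<^esub>"

type_synonym ('a, 'n) tensor_basis = "ptree \<times> 'n \<times> 'a list"

context triassociative_algebra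
begin

definition leaf_op :: "nat \<Rightarrow> ptree \<Rightarrow> 'a \<Rightarrow> 'a \<Rightarrow> 'a" where
  "leaf_op i \<psi> = (case orient i \<psi> of
     Left_oriented \<Rightarrow> (\<stileturn>) | Right_oriented \<Rightarrow> (\<turnstile>) | Middle \<Rightarrow> (\<bottom>))"

text \<open>
  The tensor product of the space on the basis \<^term>\<open>trees n\<close>, of \<open>N\<close> and of \<open>n\<close> copies of
  \<open>'a\<close> is the free module on the triples \<open>(\<psi>, x, [a\<^sub>1, \<dots>, a\<^sub>n])\<close> modulo linearity in \<open>x\<close> and in
  each \<open>a\<^sub>j\<close>. The scalars act on \<open>N\<close> through \<^const>\<open>env_scalar\<close>.
\<close>

definition chain_free ::
    "('n, 's) ring_scheme \<Rightarrow> nat \<Rightarrow> ('k, ('a, 'n) tensor_basis \<Rightarrow>\<^sub>0 'k) module" where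
  "chain_free N n =
     free_module {(\<psi>, x, as). \<psi> \<in> trees n \<and> x \<in> carrier N \<and> length as = n}"

definition chain_relations ::
    "('n, 's) ring_scheme \<Rightarrow> ('n \<Rightarrow> ('a, 'k) env_elem \<Rightarrow> 'n) \<Rightarrow> nat \<Rightarrow>
     (('a, 'n) tensor_basis \<Rightarrow>\<^sub>0 'k) set" where
  "chain_relations N act n =
    (let \<tau> = (\<lambda>\<psi> x as. Poly_Mapping.single (\<psi>, x, as) (1 :: 'k)) in
     generated_submodule ring_of_type_algebra (chain_free N n)
      ({\<tau> \<psi> (x \<oplus>\<^bsub>N\<^esub> y) as - (\<tau> \<psi> x as + \<tau> \<psi> y as) | \<psi> x y as.
          \<psi> \<in> trees n \<and> x \<in> carrier N \<and> y \<in> carrier N \<and> length as = n} \<union>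
       {\<tau> \<psi> (act x (env_scalar c)) as - pm_scale c (\<tau> \<psi> x as) | \<psi> x c as.
          \<psi> \<in> trees n \<and> x \<in> carrier N \<and> length as = n} \<union>
       {\<tau> \<psi> x (as[j := u + v]) - (\<tau> \<psi> x (as[j := u]) + \<tau> \<psi> x (as[j := v])) | \<psi> x as j u v.
          \<psi> \<in> trees n \<and> x \<in> carrier N \<and> length as = n \<and> j < n} \<union>
       {\<tau> \<psi> x (as[j := scale c u]) - pm_scale c (\<tau> \<psi> x (as[j := u])) | \<psi> x as j c u.
          \<psi> \<in> trees n \<and> x \<in> carrier N \<and> length as = n \<and> j < n}))"

definition trias_chains ::
    "('n, 's) ring_scheme \<Rightarrow> ('n \<Rightarrow> ('a, 'k) env_elem \<Rightarrow> 'n) \<Rightarrow> nat \<Rightarrow>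
     ('k, (('a, 'n) tensor_basis \<Rightarrow>\<^sub>0 'k) set) module" where
  "trias_chains N act n = quotient_module (chain_free N n) (chain_relations N act n)"

text \<open>The list \<open>[a\<^sub>1, \<dots>, a\<^sub>n]\<close> is indexed from 0, so \<open>a\<^sub>i\<close> is \<open>as ! (i - 1)\<close>.\<close>

fun basis_face ::
    "('n \<Rightarrow> ('a, 'k) env_elem \<Rightarrow> 'n) \<Rightarrow> nat \<Rightarrow> nat \<Rightarrow>
     ('a, 'n) tensor_basis \<Rightarrow> ('a, 'n) tensor_basis" where
  "basis_face act n i (\<psi>, x, as) =
     (if i = 0 then (delete_leaf i \<psi>, act x (env_gen (first_index \<psi>) (hd as)), tl as)
      else if i = n then (delete_leaf i \<psi>, act x (env_gen (last_index \<psi>) (last as)), butlast as)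
      else (delete_leaf i \<psi>, x,
        take (i - 1) as @ [leaf_op i \<psi> (as ! (i - 1)) (as ! i)] @ drop (i + 1) as))"

text \<open>The maps induced on the quotients, in the style of \<^const>\<open>rcoset_mult\<close>.\<close>

definition trias_face ::
    "('n, 's) ring_scheme \<Rightarrow> ('n \<Rightarrow> ('a, 'k) env_elem \<Rightarrow> 'n) \<Rightarrow> nat \<Rightarrow> nat \<Rightarrow>
     (('a, 'n) tensor_basis \<Rightarrow>\<^sub>0 'k) set \<Rightarrow> (('a, 'n) tensor_basis \<Rightarrow>\<^sub>0 'k) set" where
  "trias_face N act n i Y =
     (\<Union>p\<in>Y. chain_relations N act (n - 1) +>\<^bsub>chain_free N (n - 1)\<^esub>
        linear_extension (basis_face act n i) p)"

definition trias_differential ::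
    "('n, 's) ring_scheme \<Rightarrow> ('n \<Rightarrow> ('a, 'k) env_elem \<Rightarrow> 'n) \<Rightarrow> nat \<Rightarrow>
     (('a, 'n) tensor_basis \<Rightarrow>\<^sub>0 'k) set \<Rightarrow> (('a, 'n) tensor_basis \<Rightarrow>\<^sub>0 'k) set" where
  "trias_differential N act n Y =
     (\<Oplus>\<^bsub>trias_chains N act (n - 1)\<^esub>i\<in>{..n}.
        ((-1) ^ i) \<odot>\<^bsub>trias_chains N act (n - 1)\<^esub> trias_face N act n i Y)"

end

end

theory Submission
  imports Defs
begin

text \<open>
  The presimplicial identities \<open>d\<^sub>i d\<^sub>j = d\<^sub>j\<^sub>-\<^sub>1 d\<^sub>i\<close> for \<open>i < j\<close> hold on the nose for the maps
  \<^const>\<open>triassociative_algebra.basis_face\<close> on the triples \<open>(\<psi>, x, as)\<close>, for every corepresentation.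
  Deleting a leaf changes the orientation of neighbouring leaves only, so faces with \<open>j > i + 1\<close>
  commute. For two neighbouring inner leaves, the four orientations involved always match one of
  the eleven axioms, and for a face involving the first or the last leaf the identity is one of
  the 33 relations of the enveloping algebra. Hence the alternating sum of the faces squares to
  zero on the free modules. It descends to the tensor products because each face is multilinear;
  here one uses that the ground field is central in the enveloping algebra.
\<close>

section \<open>Deleting leaves of planar trees\<close>

text \<open>Chains are cosets, but \<open>basis_face\<close> sends a basis triple to a basis triple,
  so the combinatorics can be settled on single triples before linearity and quotients enter. Each
  identity splits along the three parts of a triple: deletions of leaves commute, contracted entries
  of the list agree, and the coefficients satisfy an equation in \<open>UA\<close>, because two
  successive actions on a right module are one action by a product. The obstacle is that deleting a
  leaf may suppress its vertex. A subtree with two leaves (a cherry below) collapses to a leaf,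
  which joins the parent vertex and takes a new orientation there. A root with two children may
  vanish, and the index of the coefficient is then read off from the remaining subtree, whose shape
  is arbitrary; the entries 4 to 15 of \<open>env_gen_relations\<close> serve exactly this
  situation.\<close>

lemma forest_induct [case_names Nil Leaf Node]:
  assumes "P []" "\<And>ts. P ts \<Longrightarrow> P (Leaf # ts)"
    and "\<And>us ts. P us \<Longrightarrow> P ts \<Longrightarrow> P (Node us # ts)"
  shows "P ts"
proof -
  have "P us \<Longrightarrow> P (t # us)" for t us
  proof (induction t arbitrary: us)
    case Leaf
    then show ?case by (rule assms)
  next
    case (Node vs)
    \<comment> \<open>The hypothesis for a child allows it to be put in front of any forest
      satisfying \<open>P\<close>, so every list of children satisfies \<open>P\<close>, in
      particular \<open>vs\<close>.\<close>
    have "set ws \<subseteq> set vs \<Longrightarrow> P ws" for ws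
      by (induction ws) (auto intro: assms(1) Node.IH)
    then show ?case
      using Node.prems assms(3) by blast
  qed
  then show ?thesis
    by (induction ts) (auto intro: assms(1))
qed

abbreviation reduced_forest :: "ptree list \<Rightarrow> bool" where
  "reduced_forest ts \<equiv> \<forall>t\<in>set ts. reduced t"

abbreviation forest_leaves :: "ptree list \<Rightarrow> nat" where
  "forest_leaves ts \<equiv> (\<Sum>t\<leftarrow>ts. leaves t)"

text \<open>The case expression inside \<open>delete_leaf\<close>, named so that it can carry simp
  rules. The empty list gives the tree \<open>Node []\<close>, which is not reduced; hence the
  nonemptiness conditions below.\<close>

definition graft :: "ptree list \<Rightarrow> ptree" where
  "graft ts = (case ts of [t] \<Rightarrow> t | us \<Rightarrow> Node us)"

lemma graft_simps [simp]:
  "graft [t] = t"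
  "graft (t # u # us) = Node (t # u # us)"
  by (simp_all add: graft_def)

lemma graft_Node: "length ts \<noteq> 1 \<Longrightarrow> graft ts = Node ts"
  by (auto simp: graft_def split: list.split)

lemma delete_leaf_Node [simp]: "delete_leaf i (Node ts) = graft (delete_leaf_forest i ts)"
  by (simp add: graft_def)

declare delete_leaf.simps(2) [simp del]

lemma leaves_graft [simp]: "leaves (graft ts) = forest_leaves ts"
  by (auto simp: graft_def split: list.split)

lemma reduced_graft: "reduced_forest ts \<Longrightarrow> ts \<noteq> [] \<Longrightarrow> reduced (graft ts)"
  by (auto simp: graft_def split: list.split)

lemma leaves_pos: "reduced t \<Longrightarrow> leaves t > 0"
  by (induction t) (auto simp: length_Suc_conv_rev Suc_le_length_iff numeral_2_eq_2)

lemma length_le_forest_leaves: "reduced_forest ts \<Longrightarrow> length ts \<le> forest_leaves ts"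
proof (induction ts)
  case (Cons t ts)
  then show ?case
    using leaves_pos[of t] by auto
qed simp

lemma leaves_Node_ge_2: "reduced (Node ts) \<Longrightarrow> forest_leaves ts \<ge> 2"
  using length_le_forest_leaves[of ts] by auto

lemma leaves_eq_1_iff: "reduced t \<Longrightarrow> leaves t = 1 \<longleftrightarrow> t = Leaf"
  using leaves_Node_ge_2 by (cases t) fastforce+

lemma forest_leaves_le_1:
  assumes "reduced_forest ts"
  shows "forest_leaves ts = 0 \<longleftrightarrow> ts = []" "forest_leaves ts = 1 \<longleftrightarrow> ts = [Leaf]"
proof -
  show *: "forest_leaves ts = 0 \<longleftrightarrow> ts = []"
    using length_le_forest_leaves[OF assms] by (auto simp del: sum_list_eq_0_iff)
  show "forest_leaves ts = 1 \<longleftrightarrow> ts = [Leaf]"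
  proof (cases ts)
    case (Cons t us)
    then show ?thesis
      using assms length_le_forest_leaves[of us] leaves_pos[of t] leaves_eq_1_iff[of t]
      by (auto simp: add_is_1 simp del: sum_list_eq_0_iff)
  qed simp
qed

text \<open>Both claims are proved together because a grafted child is reduced only if its forest
  stays nonempty, and this is read off from the leaf count.\<close>

lemma delete_leaf_forest_properties:
  assumes "reduced_forest ts" "i < forest_leaves ts"
  shows "forest_leaves (delete_leaf_forest i ts) = forest_leaves ts - 1
    \<and> reduced_forest (delete_leaf_forest i ts)"
  using assms
proof (induction ts arbitrary: i rule: forest_induct)
  case (Leaf ts)
  then show ?case
    by (cases i) auto
next
  case (Node us ts)
  have us: "reduced_forest us" "reduced_forest ts" and "forest_leaves us \<ge> 2"
    using Node.prems leaves_Node_ge_2[of us] by auto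
  show ?case
  proof (cases "i < forest_leaves us")
    case True
    have "forest_leaves (delete_leaf_forest i us) = forest_leaves us - 1"
      "reduced_forest (delete_leaf_forest i us)"
      using Node.IH(1)[OF us(1) True] by auto
    moreover have "delete_leaf_forest i us \<noteq> []"
      using calculation(1) \<open>2 \<le> forest_leaves us\<close> by auto
    ultimately show ?thesis
      using True us \<open>2 \<le> forest_leaves us\<close> by (auto intro: reduced_graft)
  next
    case False
    then show ?thesis
      using Node.IH(2)[of "i - forest_leaves us"] Node.prems by auto
  qed
qed auto

lemma forest_leaves_delete [simp]:
    "reduced_forest ts \<Longrightarrow> i < forest_leaves ts \<Longrightarrow>
      forest_leaves (delete_leaf_forest i ts) = forest_leaves ts - 1"
  and reduced_forest_delete [simp]:
    "reduced_forest ts \<Longrightarrow> i < forest_leaves ts \<Longrightarrow> reduced_forest (delete_leaf_forest i ts)"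
  using delete_leaf_forest_properties by blast+

lemma delete_leaf_forest_eq_Nil:
  "reduced_forest ts \<Longrightarrow> i < forest_leaves ts \<Longrightarrow>
    delete_leaf_forest i ts = [] \<longleftrightarrow> ts = [Leaf]"
  using forest_leaves_le_1(1)[OF reduced_forest_delete, of ts i] forest_leaves_le_1(2)[of ts]
  by auto

text \<open>One remaining leaf means two before, and two children with at least one leaf each leave
  room for nothing else. The cherry is the recurring exception in the inductions, since a child
  equal to \<open>Leaf\<close> is treated separately by \<open>delete_leaf_forest\<close> and
  \<open>orient_forest\<close>.\<close>

lemma delete_leaf_eq_Leaf:
  "reduced (Node us) \<Longrightarrow> i < forest_leaves us \<Longrightarrow>
    graft (delete_leaf_forest i us) = Leaf \<longleftrightarrow> us = [Leaf, Leaf]"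
proof
  assume us: "reduced (Node us)" "i < forest_leaves us"
    and eq: "graft (delete_leaf_forest i us) = Leaf"
  then have "forest_leaves us = 2"
    using leaves_graft[of "delete_leaf_forest i us"] leaves_Node_ge_2[of us] by auto
  then show "us = [Leaf, Leaf]"
  proof -
    obtain t u vs where "us = t # u # vs"
      using us(1) by (auto simp: Suc_le_length_iff numeral_2_eq_2)
    then show ?thesis
      using us(1) \<open>forest_leaves us = 2\<close> leaves_pos[of t] leaves_pos[of u]
        leaves_eq_1_iff[of t] leaves_eq_1_iff[of u] length_le_forest_leaves[of vs]
      by (auto simp del: sum_list_eq_0_iff)
  qed
next
  assume "i < forest_leaves us" "us = [Leaf, Leaf]"
  then show "graft (delete_leaf_forest i us) = Leaf"
    by auto
qed

text \<open>On \<open>[Leaf]\<close> the two sides differ: \<open>delete_leaf i Leaf\<close> has the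
  dummy value \<open>Leaf\<close>, whereas the forest version yields \<open>[]\<close>.\<close>

lemma delete_leaf_graft:
  "ts \<noteq> [Leaf] \<Longrightarrow> ts \<noteq> [] \<Longrightarrow> i < forest_leaves ts \<Longrightarrow>
    delete_leaf i (graft ts) = graft (delete_leaf_forest i ts)"
  by (auto simp: graft_def split: list.split)

text \<open>Once leaf \<open>i\<close> is gone, the old leaf \<open>j\<close> carries the number
  \<open>j - 1\<close>. Deletions in different trees of the forest are independent; two deletions in
  one child are the induction hypothesis, except in a cherry, which disappears on both
  sides.\<close>

lemma delete_leaf_forest_commute:
  assumes "reduced_forest ts" "i < j" "j < forest_leaves ts"
  shows "delete_leaf_forest i (delete_leaf_forest j ts) =
    delete_leaf_forest (j - 1) (delete_leaf_forest i ts)"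
  using assms
proof (induction ts arbitrary: i j rule: forest_induct)
  case (Leaf ts)
  then show ?case
    using less_imp_diff_less by (cases i) (auto simp: Suc_diff_le)
next
  case (Node us ts)
  let ?k = "forest_leaves us"
  have us: "reduced_forest us" "reduced_forest ts" "reduced (Node us)" and k: "?k \<ge> 2"
    using Node.prems leaves_Node_ge_2[of us] by auto
  consider "j < ?k" | "i < ?k" "?k \<le> j" | "?k \<le> i" by linarith
  then show ?case
  proof cases
    case 1
    show ?thesis
    proof (cases "us = [Leaf, Leaf]")
      case True
      then show ?thesis using 1 Node.prems by auto
    next
      case False
      \<comment> \<open>No single deletion turns this child into \<open>Leaf\<close>, so the second
        deletion passes through \<open>graft\<close> by \<open>delete_leaf_graft\<close>.\<close>
      have nl: "graft (delete_leaf_forest m us) \<noteq> Leaf" if "m < ?k" for m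
        using delete_leaf_eq_Leaf[OF us(3) that] False by simp
      then have nl': "delete_leaf_forest m us \<noteq> [Leaf]" if "m < ?k" for m
        using that by force
      have nn: "delete_leaf_forest m us \<noteq> []" if "m < ?k" for m
        using delete_leaf_forest_eq_Nil[OF us(1) that] us(3) by auto
      show ?thesis
        using 1 Node.prems(2) us k Node.IH(1)[OF us(1) \<open>i < j\<close> 1]
          nl[of i] nl[of j] nl'[of i] nl'[of j] nn[of i] nn[of j]
        by (auto simp add: delete_leaf_graft)
    qed
  next
    case 2
    then show ?thesis
      using us k by (auto simp: Suc_diff_le)
  next
    case 3
    then show ?thesis
      using us k Node.prems Node.IH(2)[of "i - ?k" "j - ?k"]
      by (auto simp: diff_commute)
  qed
qed simp

lemma delete_leaf_commute:
  assumes "reduced \<psi>" "i < j" "j < leaves \<psi>" "leaves \<psi> > 2"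
  shows "delete_leaf i (delete_leaf j \<psi>) = delete_leaf (j - 1) (delete_leaf i \<psi>)"
proof (cases \<psi>)
  case (Node us)
  have us: "reduced (Node us)" "reduced_forest us" "us \<noteq> [Leaf, Leaf]" "us \<noteq> [Leaf]"
    using assms Node by auto
  have nl: "graft (delete_leaf_forest m us) \<noteq> Leaf" if "m < leaves \<psi>" for m
    using delete_leaf_eq_Leaf[OF us(1)] us(3) that Node by simp
  then have nl: "delete_leaf_forest m us \<noteq> [Leaf]" if "m < leaves \<psi>" for m
    using that by force
  have nn: "delete_leaf_forest m us \<noteq> []" if "m < leaves \<psi>" for m
    using delete_leaf_forest_eq_Nil[OF us(2)] us(4) that Node by auto
  show ?thesis
    using assms Node us by (simp add: delete_leaf_graft nl nn delete_leaf_forest_commute)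
qed (use assms in simp)

section \<open>Orientation of the remaining leaves after a deletion\<close>

lemma orient_graft: "ts \<noteq> [Leaf] \<Longrightarrow> ts \<noteq> [] \<Longrightarrow> i < forest_leaves ts \<Longrightarrow>
    orient i (graft ts) = orient_forest True i ts"
  by (auto simp: graft_def split: list.split)

lemma orient_forest_flag:
  "0 < i \<Longrightarrow> orient_forest True i ts = orient_forest False i ts"
  by (cases ts) auto

lemma graft_delete_neq_Leaf:
  assumes "reduced (Node us)" "us \<noteq> [Leaf, Leaf]" "i < forest_leaves us"
  shows "graft (delete_leaf_forest i us) \<noteq> Leaf" "delete_leaf_forest i us \<noteq> [Leaf]"
    "delete_leaf_forest i us \<noteq> []"
proof -
  show *: "graft (delete_leaf_forest i us) \<noteq> Leaf"
    using delete_leaf_eq_Leaf[of us i] assms by simp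
  then show "delete_leaf_forest i us \<noteq> [Leaf]"
    by force
  show "delete_leaf_forest i us \<noteq> []"
    using delete_leaf_forest_eq_Nil[of us i] assms by auto
qed

text \<open>A cherry would leave \<open>Leaf\<close> behind, where \<open>orient\<close> is
  undefined while \<open>orient_forest\<close> still returns an orientation.\<close>

lemma orient_delete:
  assumes "reduced (Node us)" "us \<noteq> [Leaf, Leaf]" "i < forest_leaves us" "j < forest_leaves us - 1"
  shows "orient j (graft (delete_leaf_forest i us)) = orient_forest True j (delete_leaf_forest i us)"
  using assms by (intro orient_graft graft_delete_neq_Leaf) auto

text \<open>A leaf becomes or ceases to be an outermost child, or moves to another vertex, only when
  a leaf next to it is removed. The leaf in question has number \<open>j + 1\<close> before the
  deletion, and \<open>i < j\<close> says that it is not next to \<open>i\<close>.\<close>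

lemma orient_forest_delete_less:
  assumes "reduced_forest ts" "i < j" "j + 1 < forest_leaves ts"
  shows "orient_forest b j (delete_leaf_forest i ts) = orient_forest b (j + 1) ts"
  using assms
proof (induction ts arbitrary: b i j rule: forest_induct)
  case (Leaf ts)
  then show ?case
    using orient_forest_flag[of j ts] Leaf.IH[of "i - 1" "j - 1"] by (cases b; cases "i = 0") auto
next
  case (Node us ts)
  let ?k = "forest_leaves us"
  have us: "reduced_forest us" "reduced_forest ts" "reduced (Node us)" and k: "?k \<ge> 2"
    using Node.prems leaves_Node_ge_2[of us] by auto
  consider "j + 1 < ?k" | "i < ?k" "?k \<le> j + 1" | "?k \<le> i" by linarith
  then show ?case
  proof cases
    case 1
    have "us \<noteq> [Leaf, Leaf]"
      using 1 Node.prems by auto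
    then show ?thesis
      using 1 Node.prems(2) us k Node.IH(1)[OF us(1) \<open>i < j\<close> 1] graft_delete_neq_Leaf[OF us(3), of i]
        orient_delete[OF us(3), of i j]
      by auto
  next
    case 2
    have "j - (?k - 1) = j + 1 - ?k"
      using 2 k by simp
    then show ?thesis
      using 2 us k by auto
  next
    case 3
    then show ?thesis
      using us k Node.prems Node.IH(2)[of "i - ?k" "j - ?k"]
      by (auto simp: Suc_diff_le)
  qed
qed simp

lemma orient_forest_delete_greater:
  assumes "reduced_forest ts" "j + 1 < i" "i < forest_leaves ts"
  shows "orient_forest b j (delete_leaf_forest i ts) = orient_forest b j ts"
  using assms
proof (induction ts arbitrary: b i j rule: forest_induct)
  case (Leaf ts)
  then show ?case
    using delete_leaf_forest_eq_Nil[of ts "i - 1"] Leaf.IH[of "j - 1" "i - 1"] by (cases "j = 0") auto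
next
  case (Node us ts)
  let ?k = "forest_leaves us"
  have us: "reduced_forest us" "reduced_forest ts" "reduced (Node us)" and k: "?k \<ge> 2"
    using Node.prems leaves_Node_ge_2[of us] by auto
  consider "i < ?k" | "j < ?k" "?k \<le> i" | "?k \<le> j" by linarith
  then show ?case
  proof cases
    case 1
    have "us \<noteq> [Leaf, Leaf]"
      using 1 Node.prems by auto
    then show ?thesis
      using 1 Node.prems(2) us k Node.IH(1)[OF us(1) \<open>j + 1 < i\<close> 1] graft_delete_neq_Leaf[OF us(3), of i]
        orient_delete[OF us(3), of i j]
      by auto
  next
    case 2
    then show ?thesis
      by simp
  next
    case 3
    then show ?thesis
      using us k Node.prems Node.IH(2)[of "j - ?k" "i - ?k"]
      by (auto simp: less_diff_conv2)
  qed
qed simp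

lemma orient_forest_first:
  "reduced_forest ts \<Longrightarrow> ts \<noteq> [] \<Longrightarrow> orient_forest True 0 ts = Left_oriented"
proof (induction ts rule: forest_induct)
  case (Node us ts)
  then show ?case
    using leaves_Node_ge_2[of us] by (cases "us = []") auto
qed auto

text \<open>A single \<open>Leaf\<close> read with the flag set counts as left oriented, which the
  last premise excludes. The children of a vertex of a reduced tree always satisfy it.\<close>

lemma orient_forest_last:
  "reduced_forest ts \<Longrightarrow> ts \<noteq> [] \<Longrightarrow> b \<longrightarrow> ts \<noteq> [Leaf] \<Longrightarrow>
    orient_forest b (forest_leaves ts - 1) ts = Right_oriented"
proof (induction ts arbitrary: b rule: forest_induct)
  case (Leaf ts)
  then show ?case
    using forest_leaves_le_1(1)[of ts] by (auto simp del: sum_list_eq_0_iff)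
next
  case (Node us ts)
  have "forest_leaves us \<ge> 2" "us \<noteq> [Leaf]" "us \<noteq> []"
    using Node.prems leaves_Node_ge_2[of us] by auto
  then show ?case
    using Node forest_leaves_le_1(1)[of ts] by (cases "ts = []") (auto simp del: sum_list_eq_0_iff)
qed auto

section \<open>The operations at neighbouring leaves and the eleven axioms\<close>

context triassociative_algebra
begin

definition orient_op :: "orientation \<Rightarrow> 'a \<Rightarrow> 'a \<Rightarrow> 'a" where
  "orient_op r = (case r of
     Left_oriented \<Rightarrow> (\<stileturn>) | Right_oriented \<Rightarrow> (\<turnstile>) | Middle \<Rightarrow> (\<bottom>))"

lemma leaf_op_orient: "leaf_op i \<psi> = orient_op (orient i \<psi>)"
  by (simp add: leaf_op_def orient_op_def)

lemma orient_op_simps [simp]: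
  "orient_op Left_oriented = (\<stileturn>)" "orient_op Right_oriented = (\<turnstile>)" "orient_op Middle = (\<bottom>)"
  by (simp_all add: orient_op_def)

text \<open>Three axioms in a common form, made for the cherry: its leaves are left and right
  oriented, and deleting either of them puts a leaf in its place, whose orientation \<open>r\<close>
  is decided by the surrounding forest.\<close>

lemma orient_op_Left_Right: "orient_op r (x \<stileturn> y) z = orient_op r x (y \<turnstile> z)"
  by (cases r) (simp_all add: trias2 trias4 trias8)

text \<open>
  At the two ends of a forest the orientations are dummy values, but the identity persists there;
  the induction over subtrees relies on this.
\<close>

lemma orient_op_assoc:
  assumes "reduced_forest ts" "i + 1 < forest_leaves ts"
  shows "orient_op (orient_forest b i (delete_leaf_forest i ts))
      (orient_op (orient_forest b i ts) x y) z =
    orient_op (orient_forest b i (delete_leaf_forest (i + 1) ts)) x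
      (orient_op (orient_forest b (i + 1) ts) y z)"
  using assms
proof (induction ts arbitrary: b i rule: forest_induct)
  case (Leaf ts)
  show ?case
  proof (cases i)
    \<comment> \<open>If a leaf follows, the flag and the emptiness of the rest decide the four
      orientations, which gives \<open>trias2\<close>, \<open>trias6\<close>, \<open>trias10\<close>
      and \<open>trias11\<close>. If a larger tree follows, its first leaf is left oriented, and the
      flag chooses between \<open>trias1\<close> and \<open>trias7\<close>.\<close>
    case 0
    obtain u us where ts: "ts = u # us"
      using Leaf.prems by (cases ts) auto
    show ?thesis
    proof (cases u)
      case Leaf
      then show ?thesis
        using 0 ts trias2 trias4 trias6 trias8 trias10 trias11 by simp
    next
      case (Node vs)
      then have "forest_leaves vs \<ge> 2" "reduced_forest vs" "vs \<noteq> []"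
        using Leaf.prems ts leaves_Node_ge_2[of vs] by auto
      then show ?thesis
        using 0 ts Node orient_forest_first[of vs] trias1 trias7 by simp
    qed
  next
    case (Suc m)
    then show ?thesis
      using Leaf.IH[of m False] Leaf.prems by auto
  qed
next
  case (Node us ts)
  let ?k = "forest_leaves us"
  have us: "reduced_forest us" "reduced_forest ts" "reduced (Node us)" and k: "?k \<ge> 2"
    using Node.prems leaves_Node_ge_2[of us] by auto
  consider "i + 1 < ?k" "us = [Leaf, Leaf]" | "i + 1 < ?k" "us \<noteq> [Leaf, Leaf]"
    | "i + 1 = ?k" | "?k \<le> i" by linarith
  then show ?case
  proof cases
    case 1
    then show ?thesis
      by (simp add: orient_op_Left_Right)
  next
    case 2
    then show ?thesis
      using us k Node.IH(1)[OF us(1) 2(1)] graft_delete_neq_Leaf[OF us(3), of i]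
        graft_delete_neq_Leaf[OF us(3), of "i + 1"]
        orient_delete[OF us(3), of i i] orient_delete[OF us(3), of "i + 1" i]
      by auto
  next
    case 3
    then have i: "i = ?k - 1"
      by simp
    \<comment> \<open>Here leaf \<open>i\<close> ends one tree and leaf \<open>i + 1\<close> begins
      the next. The former is right oriented; the latter belongs to the ambient vertex
      (\<open>trias5\<close>, \<open>trias9\<close>) or is the left oriented first leaf of a subtree
      (\<open>trias3\<close>).\<close>
    have last: "orient_forest True i us = Right_oriented"
      using orient_forest_last[OF us(1)] us(3) i by fastforce
    obtain v vs where ts: "ts = v # vs"
      using Node.prems 3 by (cases ts) auto
    show ?thesis
    proof (cases v)
      case Leaf
      then show ?thesis
        using 3 k ts i us(3) last trias5 trias9 by auto
    next
      case (Node ws)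
      then have "forest_leaves ws \<ge> 2" "reduced_forest ws" "ws \<noteq> []"
        using us ts leaves_Node_ge_2[of ws] by auto
      then show ?thesis
        using 3 k i ts Node last us(3) orient_forest_first[of ws] trias3 by auto
    qed
  next
    case 4
    then show ?thesis
      using us k Node.prems Node.IH(2)[of "i - ?k" False]
      by (auto simp: Suc_diff_le)
  qed
qed simp

end

section \<open>Relations in the universal enveloping algebra\<close>

lemma sum_single_keys:
  "(\<Sum>k\<in>Poly_Mapping.keys p. Poly_Mapping.single k (Poly_Mapping.lookup p k)) = p"
  by (rule poly_mapping_eqI) (auto simp: lookup_sum lookup_single when_def in_keys_iff)

text \<open>For words, the exponent 0 is the empty word, so this is the centrality of scalars in the
  free algebra. Expanding \<open>p\<close> into monomials leaves only the commutativity of the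
  coefficients.\<close>

lemma single_zero_commute:
  "Poly_Mapping.single 0 c * p = p * Poly_Mapping.single 0 c"
  for p :: "'v::monoid_add \<Rightarrow>\<^sub>0 'k::comm_ring_1"
proof -
  have "Poly_Mapping.single 0 c * (\<Sum>k\<in>Poly_Mapping.keys p. Poly_Mapping.single k (Poly_Mapping.lookup p k))
    = (\<Sum>k\<in>Poly_Mapping.keys p. Poly_Mapping.single k (Poly_Mapping.lookup p k)) * Poly_Mapping.single 0 c"
    by (simp add: sum_distrib_left sum_distrib_right mult_single mult.commute)
  then show ?thesis
    by (simp add: sum_single_keys)
qed

lemma ring_of_type_algebra_simps [simp]:
  "carrier ring_of_type_algebra = UNIV"
  "x \<otimes>\<^bsub>ring_of_type_algebra\<^esub> y = x * y"
  "x \<oplus>\<^bsub>ring_of_type_algebra\<^esub> y = x + y"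
  "\<one>\<^bsub>ring_of_type_algebra\<^esub> = 1"
  "\<zero>\<^bsub>ring_of_type_algebra\<^esub> = 0"
  by (simp_all add: ring_of_type_algebra_def)

lemma ring_of_type_algebra_minus:
  "x \<ominus>\<^bsub>ring_of_type_algebra\<^esub> y = x - (y::'a::ring_1)"
proof -
  interpret R: ring "ring_of_type_algebra :: 'a ring"
    by (rule ring_ring_of_type_algebra)
  have "x = (x - y) \<oplus>\<^bsub>ring_of_type_algebra\<^esub> y"
    by simp
  then show ?thesis
    by (metis R.add.inv_solve_right' R.minus_eq UNIV_I ring_of_type_algebra_simps(1))
qed

section \<open>Computing with classes in the tensor algebra and in its quotient
  \<open>UA\<close>\<close>

context triassociative_algebra
begin

interpretation F: ring "ring_of_type_algebra :: ((env_index \<Rightarrow>\<^sub>0 'a) free_monoid \<Rightarrow>\<^sub>0 'k) ring"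
  by (rule ring_ring_of_type_algebra)

interpretation F: ideal "tensor_ideal sum_scale"
  "ring_of_type_algebra :: ((env_index \<Rightarrow>\<^sub>0 'a) free_monoid \<Rightarrow>\<^sub>0 'k) ring"
  unfolding tensor_ideal_def by (rule F.genideal_ideal) simp

interpretation T: ring TA
  unfolding TA_def by (rule ring_tensor_algebra)

lemma tensor_class_closed [simp]: "tensor_class sum_scale p \<in> carrier TA"
  by (auto simp: tensor_class_def TA_def tensor_algebra_def FactRing_def A_RCOSETS_def')

lemma tensor_class_add:
  "tensor_class sum_scale (p + q) = tensor_class sum_scale p \<oplus>\<^bsub>TA\<^esub> tensor_class sum_scale q"
  using F.a_rcos_sum[of p q] by (simp add: tensor_class_def TA_def tensor_algebra_def FactRing_def)

lemma tensor_class_mult: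
  "tensor_class sum_scale (p * q) = tensor_class sum_scale p \<star> tensor_class sum_scale q"
  using F.rcoset_mult_add[of p q] by (simp add: tensor_class_def TA_def tensor_algebra_def FactRing_def)

lemma tensor_class_cases:
  assumes "t \<in> carrier TA" obtains p where "t = tensor_class sum_scale p"
  using assms by (auto simp: tensor_class_def TA_def tensor_algebra_def FactRing_def A_RCOSETS_def')

lemma tensor_class_eqI:
  "p - q \<in> tensor_ideal sum_scale \<Longrightarrow> tensor_class sum_scale p = tensor_class sum_scale q"
  using F.quotient_eq_iff_same_a_r_cos[OF F.ideal_axioms, of p q]
  by (simp add: tensor_class_def ring_of_type_algebra_minus)

lemma tensor_gen_add: "tensor_gen g (a + b) = tensor_gen g a \<oplus>\<^bsub>TA\<^esub> tensor_gen g b"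
proof -
  let ?s = "Poly_Mapping.single g"
  have "letter (?s a + ?s b) - (letter (?s a) + letter (?s b)) \<in> tensor_ideal sum_scale"
    unfolding tensor_ideal_def by (rule subsetD[OF F.genideal_self]) auto
  then show ?thesis
    by (simp add: tensor_gen_def single_add tensor_class_eqI flip: tensor_class_add)
qed

lemma tensor_gen_scale:
  "tensor_gen g (scale c a) = tensor_class sum_scale (Poly_Mapping.single 0 c) \<star> tensor_gen g a"
proof -
  let ?s = "Poly_Mapping.single g"
  have "letter (sum_scale c (?s a)) - pm_scale c (letter (?s a)) \<in> tensor_ideal sum_scale"
    unfolding tensor_ideal_def by (rule subsetD[OF F.genideal_self]) auto
  moreover have "sum_scale c (?s a) = ?s (scale c a)"
    by (simp add: sum_scale_def)
  ultimately show ?thesis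
    by (simp add: tensor_gen_def tensor_class_eqI pm_scale_def mult_map_scale_conv_mult
        flip: tensor_class_mult)
qed

lemma env_relations_closed:
  "(p, q) \<in> env_relations a b \<Longrightarrow> p \<in> carrier TA \<and> q \<in> carrier TA"
  by (auto simp: env_relations_def tensor_gen_closed)

interpretation T: ideal env_ideal TA
  unfolding env_ideal_def by (rule T.genideal_ideal) (auto dest: env_relations_closed)

abbreviation env_mult (infixl \<open>\<odot>\<^sub>U\<close> 70) where "x \<odot>\<^sub>U y \<equiv> x \<otimes>\<^bsub>UA\<^esub> y"

lemma env_class_closed: "t \<in> carrier TA \<Longrightarrow> env_ideal +>\<^bsub>TA\<^esub> t \<in> carrier UA"
  by (auto simp: UA_def FactRing_def A_RCOSETS_def')

lemma env_class_cases:
  assumes "r \<in> carrier UA" obtains t where "t \<in> carrier TA" "r = env_ideal +>\<^bsub>TA\<^esub> t"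
  using assms by (auto simp: UA_def FactRing_def A_RCOSETS_def')

lemma env_class_mult:
  "s \<in> carrier TA \<Longrightarrow> t \<in> carrier TA \<Longrightarrow>
    (env_ideal +>\<^bsub>TA\<^esub> s) \<odot>\<^sub>U (env_ideal +>\<^bsub>TA\<^esub> t) = env_ideal +>\<^bsub>TA\<^esub> (s \<star> t)"
  using T.rcoset_mult_add[of s t] by (simp add: UA_def FactRing_def)

lemma env_class_add:
  "s \<in> carrier TA \<Longrightarrow> t \<in> carrier TA \<Longrightarrow>
    (env_ideal +>\<^bsub>TA\<^esub> s) \<oplus>\<^bsub>UA\<^esub> (env_ideal +>\<^bsub>TA\<^esub> t) = env_ideal +>\<^bsub>TA\<^esub> (s \<oplus>\<^bsub>TA\<^esub> t)"
  using T.a_rcos_sum[of s t] by (simp add: UA_def FactRing_def)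

lemma env_relation:
  assumes "(p, q) \<in> env_relations a b"
  shows "env_ideal +>\<^bsub>TA\<^esub> p = env_ideal +>\<^bsub>TA\<^esub> q"
proof -
  have "p \<ominus>\<^bsub>TA\<^esub> q \<in> env_ideal"
    unfolding env_ideal_def
    by (rule subsetD[OF T.genideal_self]) (use assms in \<open>auto dest: env_relations_closed\<close>)
  then show ?thesis
    using T.quotient_eq_iff_same_a_r_cos[OF T.ideal_axioms] env_relations_closed[OF assms] by blast
qed

lemma env_gen_closed [simp]: "env_gen g a \<in> carrier UA"
  by (simp add: env_gen_def env_class_closed tensor_gen_closed)

lemma env_scalar_closed [simp]: "env_scalar c \<in> carrier UA"
  by (simp add: env_scalar_def env_class_closed)

lemma env_gen_add: "env_gen g (a + b) = env_gen g a \<oplus>\<^bsub>UA\<^esub> env_gen g b"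
  by (simp add: env_gen_def tensor_gen_add env_class_add tensor_gen_closed)

text \<open>Centrality passes from the free algebra through both quotients. The scalars act on a
  corepresentation through \<open>env_scalar\<close>, so this is what makes the action of each
  element of \<open>UA\<close> linear over the ground field.\<close>

lemma env_scalar_central:
  assumes "r \<in> carrier UA"
  shows "env_scalar c \<odot>\<^sub>U r = r \<odot>\<^sub>U env_scalar c"
  using assms
proof (cases r rule: env_class_cases)
  case (1 t)
  then show ?thesis
    by (auto elim!: tensor_class_cases
        simp: env_scalar_def env_class_mult single_zero_commute simp flip: tensor_class_mult)
qed

text \<open>The scalar stands on the right so that, on a right module, it acts last; this is the
  form in which \<open>chain_relations\<close> imposes scalars on coefficients.\<close>

lemma env_gen_scale: "env_gen g (scale c a) = env_gen g a \<odot>\<^sub>U env_scalar c"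
proof -
  have "env_gen g (scale c a) = env_scalar c \<odot>\<^sub>U env_gen g a"
    by (simp add: env_gen_def tensor_gen_scale env_scalar_def env_class_mult tensor_gen_closed)
  then show ?thesis
    by (simp add: env_scalar_central)
qed

lemma env_gen_mult:
  "env_gen g a \<odot>\<^sub>U env_gen h b = env_ideal +>\<^bsub>TA\<^esub> (tensor_gen g a \<star> tensor_gen h b)"
  by (simp add: env_gen_def env_class_mult tensor_gen_closed)

text \<open>The order is that of \<open>env_relations\<close>; later steps select relations by their
  position in this list.\<close>

lemma env_gen_relations:
  "env_gen Beta_l b \<odot>\<^sub>U env_gen Beta_l a = env_gen Beta_l (a \<stileturn> b)"
  "env_gen Beta_l b \<odot>\<^sub>U env_gen Beta_l a = env_gen Beta_l (a \<bottom> b)"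
  "env_gen Beta_l b \<odot>\<^sub>U env_gen Beta_l a = env_gen Beta_l (a \<turnstile> b)"
  "env_gen Beta_l b \<odot>\<^sub>U env_gen Alpha_l a = env_gen Alpha_l a \<odot>\<^sub>U env_gen Beta_l b"
  "env_gen Beta_l b \<odot>\<^sub>U env_gen Alpha_l a = env_gen Alpha_l a \<odot>\<^sub>U env_gen Beta_m b"
  "env_gen Beta_l b \<odot>\<^sub>U env_gen Alpha_l a = env_gen Alpha_l a \<odot>\<^sub>U env_gen Beta_r b"
  "env_gen Alpha_l (a \<stileturn> b) = env_gen Alpha_l a \<odot>\<^sub>U env_gen Alpha_l b"
  "env_gen Alpha_l (a \<stileturn> b) = env_gen Alpha_l a \<odot>\<^sub>U env_gen Alpha_m b"
  "env_gen Alpha_l (a \<stileturn> b) = env_gen Alpha_l a \<odot>\<^sub>U env_gen Alpha_r b"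
  "env_gen Beta_r (a \<turnstile> b) = env_gen Beta_r b \<odot>\<^sub>U env_gen Beta_r a"
  "env_gen Beta_r (a \<turnstile> b) = env_gen Beta_r b \<odot>\<^sub>U env_gen Beta_l a"
  "env_gen Beta_r (a \<turnstile> b) = env_gen Beta_r b \<odot>\<^sub>U env_gen Beta_m a"
  "env_gen Alpha_r a \<odot>\<^sub>U env_gen Beta_r b = env_gen Beta_r b \<odot>\<^sub>U env_gen Alpha_r a"
  "env_gen Alpha_r a \<odot>\<^sub>U env_gen Beta_r b = env_gen Beta_r b \<odot>\<^sub>U env_gen Alpha_l a"
  "env_gen Alpha_r a \<odot>\<^sub>U env_gen Beta_r b = env_gen Beta_r b \<odot>\<^sub>U env_gen Alpha_m a"
  "env_gen Alpha_r a \<odot>\<^sub>U env_gen Alpha_r b = env_gen Alpha_r (a \<turnstile> b)"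
  "env_gen Alpha_r a \<odot>\<^sub>U env_gen Alpha_r b = env_gen Alpha_r (a \<stileturn> b)"
  "env_gen Alpha_r a \<odot>\<^sub>U env_gen Alpha_r b = env_gen Alpha_r (a \<bottom> b)"
  "env_gen Beta_l b \<odot>\<^sub>U env_gen Beta_r a = env_gen Beta_r (a \<stileturn> b)"
  "env_gen Beta_l b \<odot>\<^sub>U env_gen Alpha_r a = env_gen Alpha_r a \<odot>\<^sub>U env_gen Beta_l b"
  "env_gen Alpha_l (a \<turnstile> b) = env_gen Alpha_r a \<odot>\<^sub>U env_gen Alpha_l b"
  "env_gen Beta_l b \<odot>\<^sub>U env_gen Beta_m a = env_gen Beta_m (a \<stileturn> b)"
  "env_gen Beta_l b \<odot>\<^sub>U env_gen Alpha_m a = env_gen Alpha_m a \<odot>\<^sub>U env_gen Beta_l b"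
  "env_gen Alpha_l (a \<bottom> b) = env_gen Alpha_m a \<odot>\<^sub>U env_gen Alpha_l b"
  "env_gen Beta_m b \<odot>\<^sub>U env_gen Beta_l a = env_gen Beta_m (a \<turnstile> b)"
  "env_gen Beta_m b \<odot>\<^sub>U env_gen Alpha_l a = env_gen Alpha_m a \<odot>\<^sub>U env_gen Beta_r b"
  "env_gen Alpha_m (a \<stileturn> b) = env_gen Alpha_m a \<odot>\<^sub>U env_gen Alpha_r b"
  "env_gen Beta_m b \<odot>\<^sub>U env_gen Beta_r a = env_gen Beta_r (a \<bottom> b)"
  "env_gen Beta_m b \<odot>\<^sub>U env_gen Alpha_r a = env_gen Alpha_r a \<odot>\<^sub>U env_gen Beta_m b"
  "env_gen Alpha_m (a \<turnstile> b) = env_gen Alpha_r a \<odot>\<^sub>U env_gen Alpha_m b"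
  "env_gen Beta_m b \<odot>\<^sub>U env_gen Beta_m a = env_gen Beta_m (a \<bottom> b)"
  "env_gen Beta_m b \<odot>\<^sub>U env_gen Alpha_m a = env_gen Alpha_m a \<odot>\<^sub>U env_gen Beta_m b"
  "env_gen Alpha_m (a \<bottom> b) = env_gen Alpha_m a \<odot>\<^sub>U env_gen Alpha_m b"
  unfolding env_gen_mult unfolding env_gen_def
  by (rule env_relation[of _ _ a b], simp add: env_relations_def)+

end

section \<open>The first and the last leaf\<close>

lemma delete_leaf_forest_append:
  "delete_leaf_forest i (ts @ us) =
    (if i < forest_leaves ts then delete_leaf_forest i ts @ us
     else ts @ delete_leaf_forest (i - forest_leaves ts) us)"
  by (induction ts arbitrary: i) auto

lemma orient_forest_append:
  "forest_leaves ts \<le> i \<Longrightarrow>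
    orient_forest b i (ts @ us) = orient_forest (b \<and> ts = []) (i - forest_leaves ts) us"
  by (induction ts arbitrary: i b) auto

text \<open>The two outer children are displayed because \<open>first_index\<close> and
  \<open>last_index\<close> depend only on them and on whether anything lies between.\<close>

lemma reduced_Node_cases:
  assumes "reduced \<psi>" "\<psi> \<noteq> Leaf"
  obtains t ms u where "\<psi> = Node (t # ms @ [u])"
    "reduced t" "reduced u" "reduced_forest ms"
proof -
  obtain ts where ts: "\<psi> = Node ts" "length ts \<ge> 2" "reduced_forest ts"
    using assms by (cases \<psi>) auto
  then obtain t v vs where "ts = t # v # vs"
    by (auto simp: Suc_le_length_iff numeral_2_eq_2)
  moreover obtain ms u where "v # vs = ms @ [u]"
    by (metis append_butlast_last_id list.distinct(1))
  ultimately have "\<psi> = Node (t # ms @ [u])" "reduced_forest (t # ms @ [u])"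
    using ts by auto
  then show thesis
    using that by simp
qed

lemma tree_degree_pos_iff: "reduced t \<Longrightarrow> tree_degree t > 0 \<longleftrightarrow> t \<noteq> Leaf"
  using leaves_Node_ge_2 by (cases t) (fastforce simp: tree_degree_def)+

lemma first_index_Node:
  "reduced t \<Longrightarrow> first_index (Node (t # ts)) =
    (if t \<noteq> Leaf then Alpha_r else if length ts = 1 then Alpha_l else Alpha_m)"
  using tree_degree_pos_iff[of t] by auto

lemma last_index_Node:
  "reduced t \<Longrightarrow> last_index (Node (ts @ [t])) =
    (if t \<noteq> Leaf then Beta_l else if length ts = 1 then Beta_r else Beta_m)"
  using tree_degree_pos_iff[of t] by auto

declare first_index.simps(1) [simp del] last_index.simps(1) [simp del]

lemma last_index_Node_Cons:
  "reduced t \<Longrightarrow> last_index (Node (u # ts @ [t])) =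
    (if t \<noteq> Leaf then Beta_l else if ts = [] then Beta_r else Beta_m)"
  using last_index_Node[of t "u # ts"] by simp

lemma reduced_delete_leaf:
  assumes "reduced \<psi>" "\<psi> \<noteq> Leaf" "i < leaves \<psi>"
  shows "reduced (delete_leaf i \<psi>)" "leaves (delete_leaf i \<psi>) = leaves \<psi> - 1"
proof -
  obtain ts where ts: "\<psi> = Node ts" "reduced_forest ts" "length ts \<ge> 2"
    using assms by (cases \<psi>) auto
  then have "ts \<noteq> [Leaf]"
    by auto
  with ts show "reduced (delete_leaf i \<psi>)" "leaves (delete_leaf i \<psi>) = leaves \<psi> - 1"
    using assms delete_leaf_forest_eq_Nil[of ts i] by (auto intro!: reduced_graft)
qed

lemma leaves_gt_1: "reduced t \<Longrightarrow> t \<noteq> Leaf \<Longrightarrow> leaves t > 1"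
  using leaves_Node_ge_2 by (cases t) fastforce+

lemma orient_first: "reduced t \<Longrightarrow> t \<noteq> Leaf \<Longrightarrow> orient 0 t = Left_oriented"
  by (cases t) (auto intro!: orient_forest_first)

lemma orient_last: "reduced t \<Longrightarrow> t \<noteq> Leaf \<Longrightarrow> orient (leaves t - Suc 0) t = Right_oriented"
  using orient_forest_last by (cases t) fastforce+

lemma delete_leaf_neq_Leaf:
  assumes "reduced t" "i < leaves t" "leaves t \<noteq> 2"
  shows "delete_leaf i t = Leaf \<longleftrightarrow> t = Leaf"
proof
  assume *: "delete_leaf i t = Leaf"
  show "t = Leaf"
  proof (rule ccontr)
    assume t: "t \<noteq> Leaf"
    show False
      using reduced_delete_leaf(2)[OF assms(1) t assms(2)] leaves_gt_1[OF assms(1) t] assms(3) *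
      by simp
  qed
qed simp

lemma length_delete_leaf_forest:
  "i < forest_leaves ts \<Longrightarrow> length ts \<le> Suc (length (delete_leaf_forest i ts))"
  by (induction ts arbitrary: i) auto

text \<open>Two trees shrink to one only if one of them is \<open>Leaf\<close>, and its leaf is then
  the first or the last of the forest. Longer forests keep at least two trees, as at most one is
  lost.\<close>

lemma length_delete_leaf_forest_eq_1:
  assumes "reduced_forest ts" "0 < i" "i + 1 < forest_leaves ts"
  shows "length (delete_leaf_forest i ts) = 1 \<longleftrightarrow> length ts = 1"
proof -
  consider "ts = []" | t where "ts = [t]" | t u where "ts = [t, u]" | "length ts > 2"
    by (metis One_nat_def length_0_conv length_Suc_conv less_2_cases linorder_neqE_nat numeral_2_eq_2)
  then show ?thesis
  proof cases
    case 3
    then show ?thesis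
      using assms by auto
  next
    case 4
    then show ?thesis
      using length_delete_leaf_forest[of i ts] assms by auto
  qed (use assms in auto)
qed

text \<open>As long as leaves 0 and 1 and the last leaf are kept, the first subtree cannot turn into
  a leaf, the root is not suppressed, and if the first child is a leaf, the number of the other
  children cannot drop to one.\<close>

lemma first_index_delete_leaf:
  assumes "reduced \<psi>" "2 \<le> j" "j + 1 < leaves \<psi>"
  shows "first_index (delete_leaf j \<psi>) = first_index \<psi>"
proof -
  obtain t ms u where \<psi>: "\<psi> = Node (t # ms @ [u])"
    and r: "reduced t" "reduced u" "reduced_forest ms"
    using assms by (auto elim: reduced_Node_cases[of \<psi>])
  show ?thesis
  proof (cases "j < leaves t")
    case True
    then have "t \<noteq> Leaf" "delete_leaf j t \<noteq> Leaf"
      using assms delete_leaf_neq_Leaf[of t j] r by auto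
    then show ?thesis
      using True \<psi> r by (simp add: first_index_Node reduced_delete_leaf graft_Node)
  next
    case False
    let ?i = "j - leaves t" and ?ts = "ms @ [u]"
    have i: "?i + 1 < forest_leaves ?ts" "reduced_forest ?ts"
      using False assms \<psi> r by auto
    have "delete_leaf_forest ?i ?ts \<noteq> []"
      using i delete_leaf_forest_eq_Nil[of ?ts ?i] by auto
    moreover have "length (delete_leaf_forest ?i ?ts) = 1 \<longleftrightarrow> length ?ts = 1" if "t = Leaf"
      using i that assms by (intro length_delete_leaf_forest_eq_1) auto
    ultimately show ?thesis
      using False \<psi> r by (simp add: first_index_Node graft_Node)
  qed
qed

lemma last_index_delete_leaf:
  assumes "reduced \<psi>" "1 \<le> j" "j + 2 < leaves \<psi>"
  shows "last_index (delete_leaf j \<psi>) = last_index \<psi>"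
proof -
  obtain t ms u where \<psi>: "\<psi> = Node ((t # ms) @ [u])"
    and r: "reduced t" "reduced u" "reduced_forest ms"
    using assms by (auto elim: reduced_Node_cases[of \<psi>])
  let ?ts = "t # ms"
  show ?thesis
  proof (cases "j < forest_leaves ?ts")
    case False
    let ?i = "j - forest_leaves ?ts"
    have "u \<noteq> Leaf" "delete_leaf ?i u \<noteq> Leaf" "?i < leaves u"
      using False assms delete_leaf_neq_Leaf[of u ?i] r \<psi> by auto
    then show ?thesis
      using False \<psi> r unfolding \<psi> delete_leaf_Node delete_leaf_forest_append
      by (simp add: last_index_Node_Cons reduced_delete_leaf graft_Node)
  next
    case True
    have ts: "reduced_forest ?ts"
      using r by auto
    then have "delete_leaf_forest j ?ts \<noteq> []"
      using True assms delete_leaf_forest_eq_Nil[of ?ts j] by auto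
    moreover have "length (delete_leaf_forest j ?ts) = 1 \<longleftrightarrow> length ?ts = 1" if "u = Leaf"
      using ts that assms \<psi> by (intro length_delete_leaf_forest_eq_1) auto
    ultimately show ?thesis
      using True r unfolding \<psi> delete_leaf_Node delete_leaf_forest_append last_index_Node[OF r(2)]
      by (simp add: last_index_Node graft_Node del: delete_leaf_forest.simps)
  qed
qed

lemma reduced_leaves_eq_2_iff: "reduced t \<Longrightarrow> leaves t = 2 \<longleftrightarrow> t = Node [Leaf, Leaf]"
proof
  assume t: "reduced t" "leaves t = 2"
  then obtain us where us: "t = Node us" "reduced (Node us)"
    by (cases t) auto
  then have "leaves (graft (delete_leaf_forest 0 us)) = 1" "reduced (graft (delete_leaf_forest 0 us))"
    using reduced_delete_leaf[of t 0] t by auto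
  then show "t = Node [Leaf, Leaf]"
    using leaves_eq_1_iff[of "graft (delete_leaf_forest 0 us)"] delete_leaf_eq_Leaf[OF us(2), of 0] us t
    by simp
qed simp

lemma last_index_Node_2:
  "reduced u \<Longrightarrow> last_index (Node (ts @ [v, u])) =
    (if u \<noteq> Leaf then Beta_l else if ts = [] then Beta_r else Beta_m)"
  using last_index_Node[of u "ts @ [v]"] by simp

lemma delete_last_leaf:
  assumes "reduced u"
  shows "delete_leaf_forest (forest_leaves ts + leaves u - 1) (ts @ [u]) =
    (if u = Leaf then ts else ts @ [delete_leaf (leaves u - 1) u])"
  using leaves_pos[OF assms] unfolding delete_leaf_forest_append by auto

lemma first_index_cases:
  assumes "reduced t" "t \<noteq> Leaf"
  shows "first_index t \<in> {Alpha_l, Alpha_r, Alpha_m}"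
  using assms(2) by (rule reduced_Node_cases[OF assms(1)]) (auto simp: first_index_Node)

lemma last_index_cases:
  assumes "reduced t" "t \<noteq> Leaf"
  shows "last_index t \<in> {Beta_l, Beta_r, Beta_m}"
  using assms(2) by (rule reduced_Node_cases[OF assms(1)]) (auto simp: last_index_Node_Cons)

context triassociative_algebra
begin

text \<open>Needed when the deletion of an end leaf suppresses a root with two children:
  \<open>g\<close> is then the index of the remaining subtree, and all three values must give the
  same product.\<close>

lemma env_gen_mult_alpha:
  assumes "g \<in> {Alpha_l, Alpha_r, Alpha_m}"
  shows "env_gen Alpha_l a \<odot>\<^sub>U env_gen g b = env_gen Alpha_l (a \<stileturn> b)"
    and "env_gen Beta_r b \<odot>\<^sub>U env_gen g a = env_gen Alpha_r a \<odot>\<^sub>U env_gen Beta_r b"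
  using assms env_gen_relations(7-9)[of a b] env_gen_relations(13-15)[of a b]
  by (elim insertE emptyE; metis)+

lemma env_gen_mult_beta:
  assumes "g \<in> {Beta_l, Beta_r, Beta_m}"
  shows "env_gen Alpha_l a \<odot>\<^sub>U env_gen g b = env_gen Beta_l b \<odot>\<^sub>U env_gen Alpha_l a"
    and "env_gen Beta_r b \<odot>\<^sub>U env_gen g a = env_gen Beta_r (a \<turnstile> b)"
  using assms env_gen_relations(4-6)[of b a] env_gen_relations(10-12)[of a b]
  by (elim insertE emptyE; metis)+

text \<open>Needed when the outer subtree has at least three leaves: the index is then stable under
  the deletions involved, but the contracted leaf can have any orientation.\<close>

lemma env_gen_orient_op:
  "env_gen Alpha_r (orient_op r a b) = env_gen Alpha_r a \<odot>\<^sub>U env_gen Alpha_r b"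
  "env_gen Beta_l (orient_op r a b) = env_gen Beta_l b \<odot>\<^sub>U env_gen Beta_l a"
  using env_gen_relations(16-18)[of a b] env_gen_relations(1-3)[of b a] by (cases r; simp)+

text \<open>The coefficient part of \<open>d\<^sub>0 d\<^sub>1 = d\<^sub>0 d\<^sub>0\<close>: acting
  by the contraction of \<open>a\<close> and \<open>b\<close> equals acting by \<open>a\<close> and
  afterwards by \<open>b\<close>.\<close>

lemma first_index_mult:
  assumes "reduced \<psi>" "leaves \<psi> > 2"
  shows "env_gen (first_index (delete_leaf 1 \<psi>)) (leaf_op 1 \<psi> a b) =
    env_gen (first_index \<psi>) a \<odot>\<^sub>U env_gen (first_index (delete_leaf 0 \<psi>)) b"
proof -
  obtain t ms u where \<psi>: "\<psi> = Node (t # ms @ [u])"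
    and r: "reduced t" "reduced u" "reduced_forest ms"
    using assms by (auto elim: reduced_Node_cases[of \<psi>])
  \<comment> \<open>Only the shape around leaves 0 and 1 matters. In the case of two adjacent
    leaves, \<open>ms'\<close> tells whether the root keeps more than two children, which selects
    entry 24 or 33.\<close>
  consider "t = Leaf" "ms = []" "u \<noteq> Leaf"
    | ms' where "t = Leaf" "ms = Leaf # ms'"
    | m ms' where "t = Leaf" "ms = m # ms'" "m \<noteq> Leaf"
    | "t = Node [Leaf, Leaf]" | "t \<noteq> Leaf" "leaves t \<noteq> 2"
    using assms \<psi> reduced_leaves_eq_2_iff[OF r(1)]
    by (cases ms; cases "t = Leaf"; cases "u = Leaf") auto
  then show ?thesis
  proof cases
    case 1
    then show ?thesis
      using \<psi> r leaves_pos[of u] env_gen_mult_alpha[OF first_index_cases[of u]]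
      by (simp add: leaf_op_orient orient_first first_index_Node)
  next
    case 2
    then show ?thesis
      using \<psi> r by (simp add: leaf_op_orient first_index_Node graft_Node env_gen_relations(24,33))
  next
    case 3
    then show ?thesis
      using \<psi> r leaves_pos[of m]
      by (simp add: leaf_op_orient orient_first first_index_Node graft_Node env_gen_relations(27))
  next
    case 4
    then show ?thesis
      using \<psi> r by (simp add: leaf_op_orient first_index_Node graft_Node env_gen_relations(21,30))
  next
    case 5
    then have "delete_leaf 0 t \<noteq> Leaf" "delete_leaf 1 t \<noteq> Leaf" "leaves t > 1"
      using r leaves_gt_1[of t] delete_leaf_neq_Leaf[of t] by auto
    then show ?thesis
      using 5 \<psi> r
      by (simp add: leaf_op_orient first_index_Node graft_Node reduced_delete_leaf env_gen_orient_op)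
  qed
qed

text \<open>The mirror image of \<open>first_index_mult\<close>. The factors appear in reverse order
  because the outermost entry \<open>b\<close> is absorbed before \<open>a\<close>.\<close>

lemma last_index_mult:
  assumes "reduced \<psi>" "leaves \<psi> = n + 1" "n > 1"
  shows "env_gen (last_index (delete_leaf (n - 1) \<psi>)) (leaf_op (n - 1) \<psi> a b) =
    env_gen (last_index \<psi>) b \<odot>\<^sub>U env_gen (last_index (delete_leaf n \<psi>)) a"
proof -
  obtain t ms u where "\<psi> = Node (t # ms @ [u])"
    and "reduced t" "reduced u" "reduced_forest ms"
    using assms by (auto elim: reduced_Node_cases[of \<psi>])
  \<comment> \<open>The last child but one is singled out as well: it contains leaf
    \<open>n - 1\<close> when \<open>u\<close> is a leaf.\<close>
  moreover obtain ns v where "t # ms = ns @ [v]"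
    by (metis append_butlast_last_id list.distinct(1))
  ultimately have \<psi>: "\<psi> = Node (ns @ [v, u])" and r: "reduced_forest ns" "reduced v" "reduced u"
    by (metis append.assoc append_Cons append_Nil list.set_intros set_ConsD Un_iff set_append)+
  let ?L = "forest_leaves ns" and ?n = "n - 1"
  have n: "n = ?L + leaves v + leaves u - 1"
    using assms \<psi> by simp
  have del_n: "delete_leaf n \<psi> = graft (if u = Leaf then ns @ [v] else ns @ [v, delete_leaf (leaves u - 1) u])"
    unfolding n \<psi> using delete_last_leaf[OF r(3), of "ns @ [v]"] by simp
  have li: "last_index \<psi> = (if u \<noteq> Leaf then Beta_l else if ns = [] then Beta_r else Beta_m)"
    unfolding \<psi> by (rule last_index_Node_2[OF r(3)])
  consider "u = Leaf" "v = Leaf" "ns \<noteq> []" | "u = Leaf" "v \<noteq> Leaf"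
    | "u = Node [Leaf, Leaf]" | "u \<noteq> Leaf" "leaves u \<noteq> 2"
    using assms \<psi> reduced_leaves_eq_2_iff[OF r(3)] by fastforce
  then show ?thesis
  proof cases
    case 1
    have "delete_leaf ?n \<psi> = graft (ns @ [Leaf])" "leaf_op ?n \<psi> = (\<bottom>)"
      using 1 unfolding \<psi> n by (simp_all add: leaf_op_orient delete_leaf_forest_append orient_forest_append)
    then show ?thesis
      using 1 del_n li by (simp add: graft_Node last_index_Node env_gen_relations(28,31))
  next
    case 2
    have "delete_leaf ?n \<psi> = graft (ns @ [delete_leaf (leaves v - 1) v, Leaf])"
      "leaf_op ?n \<psi> = (\<turnstile>)"
      using 2 r leaves_gt_1[of v] orient_last[of v] unfolding \<psi> n
      by (auto simp: leaf_op_orient delete_leaf_forest_append orient_forest_append)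
    then show ?thesis
      using 2 del_n li r env_gen_mult_beta[OF last_index_cases[of v]]
      by (simp add: graft_Node last_index_Node last_index_Node_2 env_gen_relations(25))
  next
    case 3
    have "delete_leaf ?n \<psi> = graft (ns @ [v, Leaf])" "leaf_op ?n \<psi> = (\<stileturn>)"
      using 3 leaves_pos[OF r(2)] unfolding \<psi> n
      by (simp_all add: leaf_op_orient delete_leaf_forest_append orient_forest_append)
    then show ?thesis
      using 3 del_n li by (simp add: graft_Node last_index_Node_2 env_gen_relations(19,22))
  next
    case 4
    then have u: "delete_leaf (leaves u - 1) u \<noteq> Leaf" "delete_leaf (leaves u - 2) u \<noteq> Leaf"
        "leaves u > 2"
      using r leaves_gt_1[of u] delete_leaf_neq_Leaf[of u] by auto
    have "?n - ?L - leaves v = leaves u - 2" "\<not> ?n < ?L" "\<not> ?n - ?L < leaves v"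
      using n u(3) by auto
    then have "delete_leaf ?n \<psi> = graft (ns @ [v, delete_leaf (leaves u - 2) u])"
      using 4 u(3) unfolding \<psi> by (simp add: delete_leaf_forest_append)
    then show ?thesis
      using 4 u r del_n li
      by (simp add: graft_Node last_index_Node_2 reduced_delete_leaf leaf_op_orient env_gen_orient_op)
  qed
qed

text \<open>Removing one end leaf can change the index at the other end in two ways: the root is
  suppressed and the index comes from the other subtree, or three children become two, as in entry
  26. The combination of two leaves with nothing between is the tree of degree 1, excluded by
  \<open>n > 1\<close>.\<close>

lemma last_first_commute:
  assumes "reduced \<psi>" "leaves \<psi> = n + 1" "n > 1"
  shows "env_gen (last_index \<psi>) b \<odot>\<^sub>U env_gen (first_index (delete_leaf n \<psi>)) a =
    env_gen (first_index \<psi>) a \<odot>\<^sub>U env_gen (last_index (delete_leaf 0 \<psi>)) b"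
proof -
  obtain t ms u where \<psi>: "\<psi> = Node (t # ms @ [u])"
    and r: "reduced t" "reduced u" "reduced_forest ms"
    using assms by (auto elim: reduced_Node_cases[of \<psi>])
  have n: "n = forest_leaves (t # ms) + leaves u - 1"
    using assms \<psi> by simp
  have del_n: "delete_leaf n \<psi> = graft (if u = Leaf then t # ms else t # ms @ [delete_leaf (leaves u - 1) u])"
    unfolding n \<psi> using delete_last_leaf[OF r(2), of "t # ms"] by simp
  have del_0: "delete_leaf 0 \<psi> = graft (if t = Leaf then ms @ [u] else delete_leaf 0 t # ms @ [u])"
    unfolding \<psi> using leaves_pos[OF r(1)] by simp
  have fi: "first_index \<psi> = (if t \<noteq> Leaf then Alpha_r else if ms = [] then Alpha_l else Alpha_m)"
    unfolding \<psi> using r by (simp add: first_index_Node)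
  have li: "last_index \<psi> = (if u \<noteq> Leaf then Beta_l else if ms = [] then Beta_r else Beta_m)"
    unfolding \<psi> using r by (simp add: last_index_Node_Cons)
  note simps = del_n del_0 fi li graft_Node first_index_Node last_index_Node last_index_Node_Cons
    last_index_Node_2[of _ "[]", simplified]
  consider "t = Leaf" "ms = []" "u \<noteq> Leaf" | "t \<noteq> Leaf" "ms = []" "u = Leaf"
    | "t \<noteq> Leaf" "u \<noteq> Leaf" | "t = Leaf" "u = Leaf" "ms \<noteq> []" | "t = Leaf" "u \<noteq> Leaf" "ms \<noteq> []"
    | "t \<noteq> Leaf" "u = Leaf" "ms \<noteq> []"
    using assms \<psi> by (cases "t = Leaf"; cases "u = Leaf"; cases ms) auto
  then show ?thesis
  proof cases
    case 1
    then show ?thesis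
      using r env_gen_mult_beta[OF last_index_cases[of u]] by (simp add: simps)
  next
    case 2
    then show ?thesis
      using r env_gen_mult_alpha[OF first_index_cases[of t]] by (simp add: simps)
  qed (use r in \<open>simp add: simps env_gen_relations(20,23,26,29,32)\<close>)+
qed

end

section \<open>Quotients of free modules\<close>

lemma (in module) generated_submodule_submodule:
  assumes "S \<subseteq> carrier M"
  shows "submodule (generated_submodule R M S) R M"
proof (rule submoduleI)
  show "generated_submodule R M S \<subseteq> carrier M"
    using assms carrier_is_submodule unfolding generated_submodule_def by blast
  show "\<zero>\<^bsub>M\<^esub> \<in> generated_submodule R M S"
    using subgroup.one_closed[OF submodule.axioms(1)] by (fastforce simp: generated_submodule_def)
next
  fix v w assume "v \<in> generated_submodule R M S" "w \<in> generated_submodule R M S"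
  then show "v \<oplus>\<^bsub>M\<^esub> w \<in> generated_submodule R M S"
    by (simp add: generated_submodule_def submoduleE(5))
next
  fix v assume "v \<in> generated_submodule R M S"
  then show "\<ominus>\<^bsub>M\<^esub> v \<in> generated_submodule R M S"
    by (simp add: generated_submodule_def submoduleE(3))
next
  fix c v assume "c \<in> carrier R" "v \<in> generated_submodule R M S"
  then show "c \<odot>\<^bsub>M\<^esub> v \<in> generated_submodule R M S"
    using submoduleE(4) by (auto simp: generated_submodule_def)
qed

lemma generated_submodule_incl: "S \<subseteq> generated_submodule R M S"
  by (auto simp: generated_submodule_def)

lemma generated_submodule_least:
  "submodule H R M \<Longrightarrow> S \<subseteq> H \<Longrightarrow> generated_submodule R M S \<subseteq> H"
  by (auto simp: generated_submodule_def)

lemma (in module) abelian_subgroup_submodule: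
  assumes "submodule U R M"
  shows "abelian_subgroup U M"
  by (intro abelian_subgroupI3 additive_subgroupI submodule.axioms(1)[OF assms]
      M.abelian_group_axioms)

context module
begin

context
  fixes U assumes U: "submodule U R M"
begin

interpretation U: abelian_subgroup U M
  by (rule abelian_subgroup_submodule[OF U])

lemma quotient_carrier: "carrier (quotient_module M U) = (\<lambda>x. U +>\<^bsub>M\<^esub> x) ` carrier M"
  by (auto simp: quotient_module_def A_RCOSETS_def')

text \<open>Zero is written as a coset so that it combines with \<open>quotient_add\<close>. The
  simp rule \<open>a_coset_add_zero\<close> undoes this and is therefore removed in several later
  steps.\<close>

lemma quotient_zero: "\<zero>\<^bsub>quotient_module M U\<^esub> = U +>\<^bsub>M\<^esub> \<zero>\<^bsub>M\<^esub>"
  by (simp add: quotient_module_def U.a_subset)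

lemma quotient_add:
  "x \<in> carrier M \<Longrightarrow> y \<in> carrier M \<Longrightarrow>
    (U +>\<^bsub>M\<^esub> x) \<oplus>\<^bsub>quotient_module M U\<^esub> (U +>\<^bsub>M\<^esub> y) = U +>\<^bsub>M\<^esub> (x \<oplus>\<^bsub>M\<^esub> y)"
  by (simp add: quotient_module_def U.a_rcos_sum)

lemma coset_add_absorb:
  assumes "u \<in> U" "x \<in> carrier M"
  shows "U +>\<^bsub>M\<^esub> (u \<oplus>\<^bsub>M\<^esub> x) = U +>\<^bsub>M\<^esub> x"
proof -
  have "u \<in> carrier M" using assms U.a_subset by blast
  then show ?thesis
    using U.a_rcos_sum[of u x] U.a_rcos_const[OF assms(1)] assms U.rcosets_add_eq[of "U +>\<^bsub>M\<^esub> x"]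
    by (simp add: U.a_subset M.a_rcosetsI)
qed

lemma quotient_smult:
  assumes "c \<in> carrier R" "x \<in> carrier M"
  shows "c \<odot>\<^bsub>quotient_module M U\<^esub> (U +>\<^bsub>M\<^esub> x) = U +>\<^bsub>M\<^esub> (c \<odot>\<^bsub>M\<^esub> x)"
proof -
  \<comment> \<open>The scalar action is defined as a union over all representatives; its members
    coincide, so the union collapses to a single coset.\<close>
  have "U +>\<^bsub>M\<^esub> (c \<odot>\<^bsub>M\<^esub> y) = U +>\<^bsub>M\<^esub> (c \<odot>\<^bsub>M\<^esub> x)" if y: "y \<in> U +>\<^bsub>M\<^esub> x" for y
  proof -
    obtain u where u: "u \<in> U" "y = u \<oplus>\<^bsub>M\<^esub> x"
      using y unfolding a_r_coset_def' by auto
    have "c \<odot>\<^bsub>M\<^esub> u \<in> U" "u \<in> carrier M"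
      using submodule.smult_closed[OF U assms(1) u(1)] u(1) U.a_subset by auto
    then show ?thesis
      unfolding u(2) using assms
      by (subst smult_r_distr) (simp_all add: coset_add_absorb)
  qed
  then have "(\<Union>y\<in>U +>\<^bsub>M\<^esub> x. U +>\<^bsub>M\<^esub> (c \<odot>\<^bsub>M\<^esub> y)) = (\<Union>y\<in>U +>\<^bsub>M\<^esub> x. U +>\<^bsub>M\<^esub> (c \<odot>\<^bsub>M\<^esub> x))"
    by (rule SUP_cong[OF refl])
  also have "\<dots> = U +>\<^bsub>M\<^esub> (c \<odot>\<^bsub>M\<^esub> x)"
    using U.a_rcos_self[OF assms(2)] by blast
  finally show ?thesis
    by (simp add: quotient_module_def)
qed

lemma quotient_module_module: "module R (quotient_module M U)"
proof (rule moduleI)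
  show "abelian_group (quotient_module M U)"
  proof (rule abelian_groupI)
    fix Y assume "Y \<in> carrier (quotient_module M U)"
    then obtain x where x: "x \<in> carrier M" "Y = U +>\<^bsub>M\<^esub> x"
      by (auto simp: quotient_carrier)
    have "U +>\<^bsub>M\<^esub> (\<ominus>\<^bsub>M\<^esub> x) \<in> carrier (quotient_module M U)"
      "(U +>\<^bsub>M\<^esub> (\<ominus>\<^bsub>M\<^esub> x)) \<oplus>\<^bsub>quotient_module M U\<^esub> Y = \<zero>\<^bsub>quotient_module M U\<^esub>"
      using x by (auto simp: quotient_carrier quotient_add quotient_zero M.l_neg)
    then show "\<exists>Z\<in>carrier (quotient_module M U). Z \<oplus>\<^bsub>quotient_module M U\<^esub> Y = \<zero>\<^bsub>quotient_module M U\<^esub>"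
      by blast
  qed (auto simp: quotient_carrier quotient_add quotient_zero M.a_ac simp del: a_coset_add_zero)
qed (auto simp: quotient_carrier quotient_add quotient_smult smult_l_distr smult_r_distr
    smult_assoc1 R.cring_axioms)

lemma quotient_finsum:
  assumes "finite A" "f \<in> A \<rightarrow> carrier M"
  shows "(\<Oplus>\<^bsub>quotient_module M U\<^esub>i\<in>A. U +>\<^bsub>M\<^esub> f i) = U +>\<^bsub>M\<^esub> (\<Oplus>\<^bsub>M\<^esub>i\<in>A. f i)"
proof -
  interpret Q: module R "quotient_module M U"
    by (rule quotient_module_module)
  show ?thesis
    using assms
  proof (induction A rule: finite_induct)
    case empty
    then show ?case
      by (simp add: quotient_zero del: a_coset_add_zero)
  next
    case (insert i A)
    then have "(\<lambda>i. U +>\<^bsub>M\<^esub> f i) \<in> A \<rightarrow> carrier (quotient_module M U)"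
      "U +>\<^bsub>M\<^esub> f i \<in> carrier (quotient_module M U)"
      by (auto simp: quotient_carrier)
    then show ?case
      using insert by (simp add: quotient_add Pi_def)
  qed
qed

end

end

section \<open>Free modules and linear extensions of maps between bases\<close>

lemma lookup_pm_scale [simp]: "Poly_Mapping.lookup (pm_scale c p) k = c * Poly_Mapping.lookup p k"
  by (simp add: pm_scale_def Poly_Mapping.map.rep_eq when_def)

lemma pm_scale_simps [simp]:
  "pm_scale c 0 = 0" "pm_scale 1 p = p" "pm_scale 0 p = 0"
  "pm_scale c (Poly_Mapping.single k d) = Poly_Mapping.single k (c * d)"
  "pm_scale c (pm_scale d p) = pm_scale (c * d) p"
  by (auto intro!: poly_mapping_eqI simp: lookup_single when_def mult.assoc)

lemma pm_scale_add: "pm_scale c (p + q) = pm_scale c p + pm_scale c q"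
  by (rule poly_mapping_eqI) (simp add: lookup_add algebra_simps)

lemma pm_scale_add_left: "pm_scale (c + d) p = pm_scale c p + pm_scale d p"
  by (rule poly_mapping_eqI) (simp add: lookup_add algebra_simps)

lemma pm_scale_minus_1: "pm_scale (- 1) p = - p"
  by (rule poly_mapping_eqI) simp

lemma pm_scale_sum: "pm_scale c (sum f A) = (\<Sum>i\<in>A. pm_scale c (f i))"
  by (rule poly_mapping_eqI) (simp add: lookup_sum sum_distrib_left)

lemma keys_pm_scale: "Poly_Mapping.keys (pm_scale c p) \<subseteq> Poly_Mapping.keys p"
  by (auto simp: in_keys_iff)

lemma free_module_simps [simp]:
  "carrier (free_module B) = {p. Poly_Mapping.keys p \<subseteq> B}"
  "p \<oplus>\<^bsub>free_module B\<^esub> q = p + q"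
  "\<zero>\<^bsub>free_module B\<^esub> = 0"
  "c \<odot>\<^bsub>free_module B\<^esub> p = pm_scale c p"
  by (simp_all add: free_module_def)

lemma free_module_module:
  "Module.module (ring_of_type_algebra :: 'k::comm_ring_1 ring) (free_module B)"
proof (rule moduleI)
  show "abelian_group (free_module B :: ('k, 'a \<Rightarrow>\<^sub>0 'k) module)"
  proof (rule abelian_groupI)
    fix p :: "'a \<Rightarrow>\<^sub>0 'k"
    assume "p \<in> carrier (free_module B)"
    then have "pm_scale (- 1) p \<in> carrier (free_module B)"
      by (auto dest: keys_pm_scale[THEN subsetD])
    then show "\<exists>q\<in>carrier (free_module B). q \<oplus>\<^bsub>free_module B\<^esub> p = \<zero>\<^bsub>free_module B\<^esub>"
      by (rule bexI[rotated]) (simp add: pm_scale_minus_1)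
  qed (auto simp: add_ac dest: keys_add[THEN subsetD])
qed (auto simp: pm_scale_add pm_scale_add_left cring_from_type_algebra dest: keys_pm_scale[THEN subsetD])

lemma free_module_a_inv:
  fixes p :: "'x \<Rightarrow>\<^sub>0 'k::comm_ring_1"
  assumes "Poly_Mapping.keys p \<subseteq> B"
  shows "\<ominus>\<^bsub>free_module B\<^esub> p = - p"
proof -
  interpret M: module "ring_of_type_algebra :: 'k ring" "free_module B"
    by (rule free_module_module)
  have p: "p \<in> carrier (free_module B)" "- p \<in> carrier (free_module B)"
    using assms keys_pm_scale[of "- 1" p] by (simp_all add: pm_scale_minus_1)
  have "- p \<oplus>\<^bsub>free_module B\<^esub> p = \<zero>\<^bsub>free_module B\<^esub>"
    by simp
  then show ?thesis
    using p by (rule M.M.minus_equality)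
qed

lemma submodule_free_module_iff:
  fixes H :: "('x \<Rightarrow>\<^sub>0 'k::comm_ring_1) set"
  shows "submodule H ring_of_type_algebra (free_module B) \<longleftrightarrow>
    (\<forall>p\<in>H. Poly_Mapping.keys p \<subseteq> B) \<and> 0 \<in> H \<and> (\<forall>p\<in>H. \<forall>q\<in>H. p + q \<in> H) \<and> (\<forall>c. \<forall>p\<in>H. pm_scale c p \<in> H)"
    (is "_ \<longleftrightarrow> ?R")
proof -
  interpret M: module "ring_of_type_algebra :: 'k ring" "free_module B :: ('k, 'x \<Rightarrow>\<^sub>0 'k) module"
    by (rule free_module_module)
  show ?thesis
  proof
    assume H: "submodule H ring_of_type_algebra (free_module B)"
    show ?R
      using M.submoduleE[OF H] subgroup.one_closed[OF submodule.axioms(1)[OF H]] by auto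
  next
    assume ?R
    moreover have "- p \<in> H" if "p \<in> H" for p
      using \<open>?R\<close> that by (metis pm_scale_minus_1)
    ultimately show "submodule H ring_of_type_algebra (free_module B)"
      by (intro M.submoduleI) (auto simp: free_module_a_inv)
  qed
qed

lemma finsum_free_module:
  fixes f :: "'i \<Rightarrow> 'x \<Rightarrow>\<^sub>0 'k::comm_ring_1"
  assumes "finite A" "\<And>i. i \<in> A \<Longrightarrow> Poly_Mapping.keys (f i) \<subseteq> B"
  shows "(\<Oplus>\<^bsub>free_module B\<^esub>i\<in>A. f i) = sum f A"
proof -
  interpret M: module "ring_of_type_algebra :: 'k ring" "free_module B :: ('k, 'x \<Rightarrow>\<^sub>0 'k) module"
    by (rule free_module_module)
  show ?thesis
    using assms by (induction A rule: finite_induct) (simp_all add: Pi_def)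
qed

text \<open>The defining sum runs over the support, which may shrink by cancellation. Summing over a
  common finite superset makes additivity a termwise statement.\<close>

lemma linear_extension_superset:
  assumes "finite S" "Poly_Mapping.keys p \<subseteq> S"
  shows "linear_extension f p = (\<Sum>b\<in>S. Poly_Mapping.single (f b) (Poly_Mapping.lookup p b))"
  unfolding linear_extension_def
  using assms by (intro sum.mono_neutral_left) (auto simp: in_keys_iff)

lemma linear_extension_zero [simp]: "linear_extension f 0 = 0"
  by (simp add: linear_extension_def)

lemma linear_extension_single [simp]:
  "linear_extension f (Poly_Mapping.single b c) = Poly_Mapping.single (f b) c"
  by (subst linear_extension_superset[of "{b}"]) auto

lemma linear_extension_add:
  "linear_extension f (p + q) = linear_extension f p + linear_extension f q"
proof -
  let ?S = "Poly_Mapping.keys p \<union> Poly_Mapping.keys q"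
  have "linear_extension f r = (\<Sum>b\<in>?S. Poly_Mapping.single (f b) (Poly_Mapping.lookup r b))"
    if "r \<in> {p, q, p + q}" for r
    using that keys_add[of p q] by (intro linear_extension_superset) auto
  then show ?thesis
    by (simp add: lookup_add single_add sum.distrib)
qed

lemma linear_extension_pm_scale:
  "linear_extension f (pm_scale c p) = pm_scale c (linear_extension f p)"
proof -
  have "linear_extension f (pm_scale c p) =
      (\<Sum>b\<in>Poly_Mapping.keys p. Poly_Mapping.single (f b) (c * Poly_Mapping.lookup p b))"
    using linear_extension_superset[OF finite_keys keys_pm_scale] by simp
  then show ?thesis
    by (simp add: linear_extension_def pm_scale_sum)
qed

lemma linear_extension_diff:
  "linear_extension f (p - q) = linear_extension f p - linear_extension f q"
  using linear_extension_add[of f p "- q"] linear_extension_pm_scale[of f "- 1" q]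
  by (simp add: pm_scale_minus_1)

lemma linear_extension_sum:
  "linear_extension f (sum g A) = (\<Sum>i\<in>A. linear_extension f (g i))"
  by (induction A rule: infinite_finite_induct) (simp_all add: linear_extension_add)

lemma linear_extension_linear_extension:
  "linear_extension f (linear_extension g p) = linear_extension (f \<circ> g) p"
  unfolding linear_extension_def[of g] linear_extension_sum linear_extension_single
  by (simp add: linear_extension_def)

lemma linear_extension_cong:
  "(\<And>b. b \<in> Poly_Mapping.keys p \<Longrightarrow> f b = g b) \<Longrightarrow> linear_extension f p = linear_extension g p"
  by (simp add: linear_extension_def)

lemma keys_linear_extension: "Poly_Mapping.keys (linear_extension f p) \<subseteq> f ` Poly_Mapping.keys p"
proof
  fix y assume "y \<in> Poly_Mapping.keys (linear_extension f p)"
  then have "(\<Sum>b\<in>Poly_Mapping.keys p. Poly_Mapping.lookup (Poly_Mapping.single (f b) (Poly_Mapping.lookup p b)) y) \<noteq> 0"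
    by (simp add: in_keys_iff linear_extension_def lookup_sum)
  then obtain b where "b \<in> Poly_Mapping.keys p"
      "Poly_Mapping.lookup (Poly_Mapping.single (f b) (Poly_Mapping.lookup p b)) y \<noteq> 0"
    by (metis (no_types, lifting) sum.not_neutral_contains_not_neutral)
  then show "y \<in> f ` Poly_Mapping.keys p"
    by (auto simp: lookup_single when_def split: if_splits)
qed

text \<open>The preimage of \<open>H\<close> is a submodule of the free module, so it contains
  everything generated by \<open>S\<close> as soon as it contains \<open>S\<close>.\<close>

lemma linear_extension_generated_submodule:
  fixes S :: "('x \<Rightarrow>\<^sub>0 'k::comm_ring_1) set"
  assumes H: "submodule H ring_of_type_algebra (free_module B')"
    and S: "S \<subseteq> carrier (free_module B)"
    and "\<And>p. p \<in> S \<Longrightarrow> linear_extension f p \<in> H"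
    and "p \<in> generated_submodule ring_of_type_algebra (free_module B) S"
  shows "linear_extension f p \<in> H"
proof -
  let ?P = "{p. Poly_Mapping.keys p \<subseteq> B \<and> linear_extension f p \<in> H}"
  have "p + q \<in> ?P" if "p \<in> ?P" "q \<in> ?P" for p q
    using that H keys_add[of p q] by (auto simp: submodule_free_module_iff linear_extension_add)
  moreover have "pm_scale c p \<in> ?P" if "p \<in> ?P" for p c
    using that H keys_pm_scale[of c p]
    by (auto simp: submodule_free_module_iff linear_extension_pm_scale)
  moreover have "0 \<in> ?P"
    using H by (simp add: submodule_free_module_iff)
  ultimately have "submodule ?P ring_of_type_algebra (free_module B)"
    unfolding submodule_free_module_iff by blast
  then show ?thesis
    using generated_submodule_least[of ?P ring_of_type_algebra "free_module B" S] assms by auto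
qed

section \<open>The presimplicial identities\<close>

lemma trees_iff: "\<psi> \<in> trees n \<longleftrightarrow> reduced \<psi> \<and> leaves \<psi> = n + 1"
  by (simp add: trees_def)

lemma delete_leaf_trees:
  "\<psi> \<in> trees n \<Longrightarrow> 0 < n \<Longrightarrow> i \<le> n \<Longrightarrow> delete_leaf i \<psi> \<in> trees (n - 1)"
  using reduced_delete_leaf[of \<psi> i] by (cases "\<psi> = Leaf") (auto simp: trees_iff)

text \<open>The entries contracted at the leaf \<open>i\<close> are \<open>a\<^sub>i\<close> and \<open>a\<^sub>i\<^sub>+\<^sub>1\<close>, at list positions \<open>i - 1\<close> and \<open>i\<close>.\<close>

definition merge :: "nat \<Rightarrow> ('b \<Rightarrow> 'b \<Rightarrow> 'b) \<Rightarrow> 'b list \<Rightarrow> 'b list" where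
  "merge i f as = take (i - 1) as @ [f (as ! (i - 1)) (as ! i)] @ drop (i + 1) as"

lemma merge_append:
  "i = Suc (length us) \<Longrightarrow> merge i f (us @ a # b # vs) = us @ f a b # vs"
  by (simp add: merge_def nth_append)

text \<open>Trades the position \<open>i\<close> for a decomposition of the list, on which
  \<open>merge_append\<close> evaluates every contraction.\<close>

lemma ex_list_split_two:
  assumes "0 < i" "i < length as"
  shows "\<exists>us a b vs. as = us @ a # b # vs \<and> i = Suc (length us)"
proof -
  have "as ! (i - 1) # as ! i # drop (Suc i) as = drop (i - 1) as"
    using assms Cons_nth_drop_Suc[of "i - 1" as] Cons_nth_drop_Suc[of i as] by simp
  then have "as = take (i - 1) as @ as ! (i - 1) # as ! i # drop (Suc i) as"
    by (metis append_take_drop_id)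
  moreover have "i = Suc (length (take (i - 1) as))"
    using assms by simp
  ultimately show ?thesis
    by blast
qed

lemma length_merge: "0 < i \<Longrightarrow> i < length as \<Longrightarrow> length (merge i f as) = length as - 1"
  using ex_list_split_two[of i as] by (auto simp: merge_append)

lemma tl_merge:
  assumes "2 \<le> i" "i < length as"
  shows "hd (merge i f as) = hd as" "tl (merge i f as) = merge (i - 1) f (tl as)"
proof -
  obtain us a b vs where *: "as = us @ a # b # vs" "i = Suc (length us)"
    using ex_list_split_two[of i as] assms by auto
  then obtain u us' where "us = u # us'"
    using assms by (cases us) auto
  then show "hd (merge i f as) = hd as" "tl (merge i f as) = merge (i - 1) f (tl as)"
    using * by (simp_all only: merge_append) (simp_all add: merge_append)
qed

lemma butlast_merge:
  assumes "0 < i" "i + 1 < length as"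
  shows "last (merge i f as) = last as" "butlast (merge i f as) = merge i f (butlast as)"
proof -
  obtain us a b vs where *: "as = us @ a # b # vs" "i = Suc (length us)"
    using ex_list_split_two[of i as] assms by auto
  moreover have "vs \<noteq> []"
    using assms * by auto
  ultimately show "last (merge i f as) = last as" "butlast (merge i f as) = merge i f (butlast as)"
    by (simp_all add: merge_append butlast_append)
qed

lemma merge_merge:
  assumes "0 < i" "i + 1 < j" "j < length as"
  shows "merge i f (merge j g as) = merge (j - 1) g (merge i f as)"
proof -
  obtain us a b vs where as: "as = us @ a # b # vs" "i = Suc (length us)"
    using ex_list_split_two[of i as] assms by auto
  have "0 < j - i - 1" "j - i - 1 < length vs"
    using assms as by auto
  then obtain us' c d ws where vs: "vs = us' @ c # d # ws" "j - i - 1 = Suc (length us')"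
    using ex_list_split_two[of "j - i - 1" vs] by blast
  have j: "j = Suc (length (us @ a # b # us'))"
    using assms as vs by simp
  have "merge j g as = us @ a # b # us' @ g c d # ws"
    using as vs merge_append[OF j, of g c d ws] by simp
  moreover have "merge (j - 1) g (us @ f a b # us' @ c # d # ws) = us @ f a b # us' @ g c d # ws"
    using merge_append[of "j - 1" "us @ f a b # us'" g c d ws] j by simp
  ultimately show ?thesis
    using as vs by (simp add: merge_append)
qed

section \<open>Contractions and faces on basis triples\<close>

context triassociative_algebra
begin

lemma leaf_op_delete_less:
  assumes "\<psi> \<in> trees n" "i < j" "j < n"
  shows "leaf_op j (delete_leaf i \<psi>) = leaf_op (j + 1) \<psi>"
proof -
  obtain us where \<psi>: "\<psi> = Node us" "reduced (Node us)" "forest_leaves us = n + 1"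
    using assms by (cases \<psi>) (auto simp: trees_iff)
  moreover have "us \<noteq> [Leaf, Leaf]"
    using assms \<psi> by auto
  ultimately show ?thesis
    using assms orient_delete[OF \<psi>(2), of i j] orient_forest_delete_less[of us i j True]
    by (auto simp: leaf_op_orient)
qed

lemma leaf_op_delete_greater:
  assumes "\<psi> \<in> trees n" "j + 1 < i" "i \<le> n"
  shows "leaf_op j (delete_leaf i \<psi>) = leaf_op j \<psi>"
proof -
  obtain us where \<psi>: "\<psi> = Node us" "reduced (Node us)" "forest_leaves us = n + 1"
    using assms by (cases \<psi>) (auto simp: trees_iff)
  moreover have "us \<noteq> [Leaf, Leaf]"
    using assms \<psi> by auto
  ultimately show ?thesis
    using assms orient_delete[OF \<psi>(2), of i j] orient_forest_delete_greater[of us j i True]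
    by (auto simp: leaf_op_orient)
qed

lemma leaf_op_assoc:
  assumes "\<psi> \<in> trees n" "i < n" "1 < n"
  shows "leaf_op i (delete_leaf i \<psi>) (leaf_op i \<psi> x y) z =
    leaf_op i (delete_leaf (i + 1) \<psi>) x (leaf_op (i + 1) \<psi> y z)"
proof -
  obtain us where \<psi>: "\<psi> = Node us" "reduced (Node us)" "forest_leaves us = n + 1"
    using assms by (cases \<psi>) (auto simp: trees_iff)
  moreover have "us \<noteq> [Leaf, Leaf]"
    using assms \<psi> by auto
  ultimately show ?thesis
    using assms orient_delete[OF \<psi>(2), of i i] orient_delete[OF \<psi>(2), of "i + 1" i]
      orient_op_assoc[of us i True x y z]
    by (auto simp: leaf_op_orient)
qed

definition chain_basis :: "('n, 's) ring_scheme \<Rightarrow> nat \<Rightarrow> ('a, 'n) tensor_basis set" where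
  "chain_basis N n = {(\<psi>, x, as). \<psi> \<in> trees n \<and> x \<in> carrier N \<and> length as = n}"

lemma basis_face_simps:
  "basis_face act n 0 (\<psi>, x, as) =
    (delete_leaf 0 \<psi>, act x (env_gen (first_index \<psi>) (hd as)), tl as)"
  "0 < n \<Longrightarrow> basis_face act n n (\<psi>, x, as) =
    (delete_leaf n \<psi>, act x (env_gen (last_index \<psi>) (last as)), butlast as)"
  "0 < i \<Longrightarrow> i < n \<Longrightarrow> basis_face act n i (\<psi>, x, as) =
    (delete_leaf i \<psi>, x, merge i (leaf_op i \<psi>) as)"
  by (auto simp: merge_def)

declare basis_face.simps [simp del]

lemma basis_face_closed:
  assumes "corepresentation N act" "b \<in> chain_basis N n" "0 < n" "i \<le> n"
  shows "basis_face act n i b \<in> chain_basis N (n - 1)"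
proof -
  interpret N: right_module UA N act by fact
  obtain \<psi> x as where b: "b = (\<psi>, x, as)" "\<psi> \<in> trees n" "x \<in> carrier N" "length as = n"
    using assms by (auto simp: chain_basis_def)
  consider "i = 0" | "i = n" | "0 < i" "i < n"
    using assms by linarith
  then show ?thesis
    using b assms
      delete_leaf_trees[of \<psi> n i]
    by cases (auto simp: chain_basis_def basis_face_simps length_merge N.act_closed)
qed

text \<open>The tree part is \<open>delete_leaf_commute\<close> throughout. If two actions on the
  coefficient meet, \<open>act_mult\<close> turns them into a product in \<open>UA\<close>, covered
  by \<open>first_index_mult\<close>, \<open>last_index_mult\<close> or
  \<open>last_first_commute\<close>. Two adjacent contractions use \<open>leaf_op_assoc\<close>; in
  the remaining cases orientations and indices are unchanged and only lists are compared.\<close>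

lemma basis_face_commute:
  assumes "corepresentation N act" "b \<in> chain_basis N n" "1 < n" "i < j" "j \<le> n"
  shows "basis_face act (n - 1) i (basis_face act n j b) =
    basis_face act (n - 1) (j - 1) (basis_face act n i b)"
proof -
  interpret N: right_module UA N act by fact
  obtain \<psi> x as where b: "b = (\<psi>, x, as)"
    and \<psi>: "\<psi> \<in> trees n" and x: "x \<in> carrier N" and as: "length as = n"
    using assms by (auto simp: chain_basis_def)
  have red: "reduced \<psi>" "leaves \<psi> = n + 1"
    using \<psi> by (auto simp: trees_iff)
  have del: "delete_leaf i (delete_leaf j \<psi>) = delete_leaf (j - 1) (delete_leaf i \<psi>)"
    using delete_leaf_commute[of \<psi> i j] red assms by simp
  consider "i = 0" "j = n" | "i = 0" "j = 1" | "i = 0" "2 \<le> j" "j < n" | "0 < i" "i = n - 1" "j = n"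
    | "0 < i" "i < n - 1" "j = n" | "0 < i" "j = i + 1" "j < n" | "0 < i" "i + 1 < j" "j < n"
    using assms by (cases "i = 0"; cases "j = n"; cases "j = i + 1") auto
  then show ?thesis
  proof cases
    case 1
    obtain a cs c where "as = a # cs @ [c]"
      using as \<open>1 < n\<close> by (cases as; cases "tl as" rule: rev_cases) auto
    then show ?thesis
      using 1 assms b x del last_first_commute[OF red \<open>1 < n\<close>, of c a]
      by (simp add: basis_face_simps flip: N.act_mult)
  next
    case 2
    obtain a c cs where "as = a # c # cs"
      using as \<open>1 < n\<close> by (cases as; cases "tl as") auto
    then show ?thesis
      using 2 assms b x del first_index_mult[of \<psi> a c] red
      by (simp add: basis_face_simps merge_def flip: N.act_mult)
  next
    case 3
    have "leaf_op (j - 1) (delete_leaf 0 \<psi>) = leaf_op j \<psi>"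
      using leaf_op_delete_less[OF \<psi>, of 0 "j - 1"] 3 by simp
    then show ?thesis
      using 3 assms b as del first_index_delete_leaf[of \<psi> j] red
      by (simp add: basis_face_simps tl_merge)
  next
    case 4
    obtain cs a c where cs: "as = cs @ [a, c]" "length cs = n - 2"
      using as \<open>1 < n\<close> by (cases as rule: rev_cases; cases "butlast as" rule: rev_cases) auto
    have "merge i (leaf_op i \<psi>) as = cs @ [leaf_op i \<psi> a c]"
      using cs 4 assms by (simp add: merge_append)
    then show ?thesis
      using 4 assms b x cs del last_index_mult[OF red \<open>1 < n\<close>, of a c]
      by (simp add: basis_face_simps butlast_append flip: N.act_mult)
  next
    case 5
    have "leaf_op i (delete_leaf n \<psi>) = leaf_op i \<psi>"
      using leaf_op_delete_greater[OF \<psi>, of i n] 5 by simp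
    then show ?thesis
      using 5 assms b as del last_index_delete_leaf[of \<psi> i] red
      by (simp add: basis_face_simps butlast_merge)
  next
    case 6
    obtain us a c vs where us: "as = us @ a # c # vs" "i = Suc (length us)"
      using ex_list_split_two[of i as] as 6 by auto
    obtain e ws where vs: "vs = e # ws"
      using us as 6 by (cases vs) auto
    have j: "merge j f as = us @ a # f c e # ws" for f
      using merge_append[of j "us @ [a]" f c e ws] us vs 6 by simp
    have "merge i f (merge j g as) = us @ f a (g c e) # ws"
      "merge i f (merge i g as) = us @ f (g a c) e # ws" for f g
      unfolding j using us by (simp_all add: vs merge_append)
    then show ?thesis
      using 6 assms b del leaf_op_assoc[OF \<psi>, of i a c e]
      by (simp add: basis_face_simps)
  next
    case 7
    have "leaf_op i (delete_leaf j \<psi>) = leaf_op i \<psi>" "leaf_op (j - 1) (delete_leaf i \<psi>) = leaf_op j \<psi>"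
      using leaf_op_delete_greater[OF \<psi>, of i j] leaf_op_delete_less[OF \<psi>, of i "j - 1"] 7 by auto
    then show ?thesis
      using 7 assms b as del by (simp add: basis_face_simps merge_merge)
  qed
qed

end

section \<open>Descent to the tensor products\<close>

lemma keys_diff_subset: "Poly_Mapping.keys (p - q) \<subseteq> Poly_Mapping.keys p \<union> Poly_Mapping.keys q"
  for p q :: "'x \<Rightarrow>\<^sub>0 'k::ab_group_add"
  by (auto simp: in_keys_iff lookup_minus)

text \<open>The map \<open>(i, j)\<close> to \<open>(j - 1, i)\<close> is a bijection from the pairs
  with \<open>i < j\<close> to those with \<open>j \<le> i\<close>. It lowers \<open>i + j\<close>
  by one, so matched terms cancel.\<close>

lemma sum_sum_alternating_eq_0:
  fixes F :: "nat \<Rightarrow> nat \<Rightarrow> 'x \<Rightarrow>\<^sub>0 'k::comm_ring_1"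
  assumes "\<And>i j. i < j \<Longrightarrow> j \<le> Suc n \<Longrightarrow> F i j = F (j - 1) i"
  shows "(\<Sum>i\<le>n. \<Sum>j\<le>Suc n. pm_scale ((-1) ^ (i + j)) (F i j)) = 0"
proof -
  let ?G = "\<lambda>(i, j). pm_scale ((-1) ^ (i + j)) (F i j)"
  let ?A = "{(i, j). i < j \<and> j \<le> Suc n}" and ?B = "{(i, j). j \<le> i \<and> i \<le> n}"
  have fin: "finite ?A" "finite ?B"
    by (auto intro: finite_subset[of _ "{..Suc n} \<times> {..Suc n}"])
  have "(\<Sum>i\<le>n. \<Sum>j\<le>Suc n. pm_scale ((-1) ^ (i + j)) (F i j)) = sum ?G ({..n} \<times> {..Suc n})"
    by (simp only: sum.cartesian_product)
  also have "{..n} \<times> {..Suc n} = ?A \<union> ?B"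
    by auto
  also have "sum ?G (?A \<union> ?B) = sum ?G ?A + sum ?G ?B"
    using fin by (intro sum.union_disjoint) auto
  also have "sum ?G ?A = (\<Sum>(i, j)\<in>?B. - pm_scale ((-1) ^ (i + j)) (F i j))"
  proof (rule sum.reindex_bij_witness[where j = "\<lambda>(i, j). (j - 1, i)" and i = "\<lambda>(i, j). (j, i + 1)"])
    fix p assume "p \<in> ?A"
    then obtain i j where p: "p = (i, Suc j)" "i \<le> j" "j \<le> n"
      by (cases p; cases "snd p") auto
    then show "(case case p of (i, j) \<Rightarrow> (j - 1, i) of (i, j) \<Rightarrow> - pm_scale ((-1) ^ (i + j)) (F i j)) = ?G p"
      using assms[of i "Suc j"] by (simp add: add.commute flip: pm_scale_minus_1)
  qed auto
  finally show ?thesis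
    by (simp add: sum_negf case_prod_unfold)
qed

context triassociative_algebra
begin

lemma linear_orient_op:
  "Vector_Spaces.linear scale scale (\<lambda>x. orient_op r x y)"
  "Vector_Spaces.linear scale scale (\<lambda>y. orient_op r x y)"
  by (cases r; use linear_left linear_right linear_mid in simp)+

lemma orient_op_add:
  "orient_op r (x + y) z = orient_op r x z + orient_op r y z"
  "orient_op r z (x + y) = orient_op r z x + orient_op r z y"
  using linear_orient_op(1)[of r z] linear_orient_op(2)[of r z] unfolding Vector_Spaces.linear_iff
  by blast+

lemma orient_op_scale:
  "orient_op r (scale c x) z = scale c (orient_op r x z)"
  "orient_op r z (scale c x) = scale c (orient_op r z x)"
  using linear_orient_op(1)[of r z] linear_orient_op(2)[of r z] unfolding Vector_Spaces.linear_iff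
  by blast+

lemma chain_free_eq: "chain_free N n = free_module (chain_basis N n)"
  by (simp add: chain_free_def chain_basis_def)

definition basis_vec :: "ptree \<Rightarrow> 'n \<Rightarrow> 'a list \<Rightarrow> (('a, 'n) tensor_basis \<Rightarrow>\<^sub>0 'k)" where
  "basis_vec \<psi> x as = Poly_Mapping.single (\<psi>, x, as) 1"

text \<open>The generating set inside \<open>chain_relations\<close>, separated from its span so
  that the descent can be tested on generators.\<close>

definition chain_generators ::
    "('n, 's) ring_scheme \<Rightarrow> ('n \<Rightarrow> ('a, 'k) env_elem \<Rightarrow> 'n) \<Rightarrow> nat \<Rightarrow>
     (('a, 'n) tensor_basis \<Rightarrow>\<^sub>0 'k) set" where
  "chain_generators N act n =
      {basis_vec \<psi> (x \<oplus>\<^bsub>N\<^esub> y) as - (basis_vec \<psi> x as + basis_vec \<psi> y as) | \<psi> x y as.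
          \<psi> \<in> trees n \<and> x \<in> carrier N \<and> y \<in> carrier N \<and> length as = n} \<union>
       {basis_vec \<psi> (act x (env_scalar c)) as - pm_scale c (basis_vec \<psi> x as) | \<psi> x c as.
          \<psi> \<in> trees n \<and> x \<in> carrier N \<and> length as = n} \<union>
       {basis_vec \<psi> x (as[j := u + v]) - (basis_vec \<psi> x (as[j := u]) + basis_vec \<psi> x (as[j := v])) | \<psi> x as j u v.
          \<psi> \<in> trees n \<and> x \<in> carrier N \<and> length as = n \<and> j < n} \<union>
       {basis_vec \<psi> x (as[j := scale c u]) - pm_scale c (basis_vec \<psi> x (as[j := u])) | \<psi> x as j c u.
          \<psi> \<in> trees n \<and> x \<in> carrier N \<and> length as = n \<and> j < n}"

lemma chain_relations_eq:
  "chain_relations N act n =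
    generated_submodule ring_of_type_algebra (free_module (chain_basis N n)) (chain_generators N act n)"
  unfolding chain_relations_def chain_free_eq chain_generators_def basis_vec_def Let_def ..

lemma chain_generators_subset:
  assumes "corepresentation N act"
  shows "chain_generators N act n \<subseteq> carrier (free_module (chain_basis N n))"
proof -
  interpret N: right_module UA N act by fact
  have "Poly_Mapping.keys (basis_vec \<psi> x as) \<subseteq> chain_basis N n"
    if "\<psi> \<in> trees n" "x \<in> carrier N" "length as = n" for \<psi> x as
    using that by (simp add: basis_vec_def chain_basis_def)
  then show ?thesis
    unfolding chain_generators_def free_module_simps
    by (intro Un_least subsetI; elim CollectE exE conjE; hypsubst; intro CollectI
        order_trans[OF keys_diff_subset] order_trans[OF keys_add] order_trans[OF keys_pm_scale] Un_least)
      (simp_all add: N.act_closed)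
qed

lemma chain_relations_submodule:
  assumes "corepresentation N act"
  shows "submodule (chain_relations N act n) ring_of_type_algebra (free_module (chain_basis N n))"
  unfolding chain_relations_eq
  by (intro module.generated_submodule_submodule free_module_module chain_generators_subset assms)

lemma chain_relationsI:
  "p \<in> chain_generators N act n \<Longrightarrow> p \<in> chain_relations N act n"
  unfolding chain_relations_eq by (rule subsetD[OF generated_submodule_incl])

lemma relation_add_coefficient:
  assumes "\<psi> \<in> trees n" "x \<in> carrier N" "y \<in> carrier N" "length as = n"
  shows "basis_vec \<psi> (x \<oplus>\<^bsub>N\<^esub> y) as - (basis_vec \<psi> x as + basis_vec \<psi> y as) \<in> chain_relations N act n"
  by (rule chain_relationsI) (use assms in \<open>unfold chain_generators_def; blast\<close>)

lemma relation_scale_coefficient: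
  assumes "\<psi> \<in> trees n" "x \<in> carrier N" "length as = n"
  shows "basis_vec \<psi> (act x (env_scalar c)) as - pm_scale c (basis_vec \<psi> x as) \<in> chain_relations N act n"
  by (rule chain_relationsI) (use assms in \<open>unfold chain_generators_def; blast\<close>)

lemma relation_add_entry:
  assumes "\<psi> \<in> trees n" "x \<in> carrier N" "length as = n" "j < n"
  shows "basis_vec \<psi> x (as[j := u + v]) - (basis_vec \<psi> x (as[j := u]) + basis_vec \<psi> x (as[j := v]))
    \<in> chain_relations N act n"
  by (rule chain_relationsI) (use assms in \<open>unfold chain_generators_def; blast\<close>)

lemma relation_scale_entry:
  assumes "\<psi> \<in> trees n" "x \<in> carrier N" "length as = n" "j < n"
  shows "basis_vec \<psi> x (as[j := scale c u]) - pm_scale c (basis_vec \<psi> x (as[j := u]))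
    \<in> chain_relations N act n"
  by (rule chain_relationsI) (use assms in \<open>unfold chain_generators_def; blast\<close>)

text \<open>Seen as a map of the coefficient alone, every face is the action of one fixed element of
  \<open>UA\<close>: a generator for the two end faces and the unit for the inner ones. Neither
  \<open>r\<close> nor \<open>cs\<close> depends on \<open>x\<close>.\<close>

lemma basis_face_coefficient:
  assumes "corepresentation N act" "\<psi> \<in> trees n" "length as = n" "0 < n" "i \<le> n"
  obtains r cs where "r \<in> carrier UA" "length cs = n - 1"
    "\<And>x. x \<in> carrier N \<Longrightarrow> basis_face act n i (\<psi>, x, as) = (delete_leaf i \<psi>, act x r, cs)"
proof -
  interpret N: right_module UA N act by fact
  consider "i = 0" | "i = n" | "0 < i" "i < n"
    using assms by linarith
  then show thesis
  proof cases
    case 3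
    then show thesis
      using assms by (intro that[of "\<one>\<^bsub>UA\<^esub>" "merge i (leaf_op i \<psi>) as"])
        (auto simp: basis_face_simps length_merge N.act_one)
  qed (use assms in \<open>intro that; simp add: basis_face_simps\<close>)+
qed

lemma merge_update:
  assumes "0 < i" "i < length as" "j < length as"
  shows "merge i f (as[j := w]) =
    (if j = i - 1 then (merge i f as)[i - 1 := f w (as ! i)]
     else if j = i then (merge i f as)[i - 1 := f (as ! (i - 1)) w]
     else if j < i then (merge i f as)[j := w] else (merge i f as)[j - 1 := w])"
proof -
  obtain us a b vs where as: "as = us @ a # b # vs" "i = Suc (length us)"
    using ex_list_split_two[of i as] assms by auto
  consider "j < length us" | "j = length us" | "j = Suc (length us)" | "Suc (Suc (length us)) \<le> j"
    by linarith
  then show ?thesis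
  proof cases
    case 1
    then show ?thesis
      unfolding as by (simp add: merge_append list_update_append nth_append)
  next
    case 2
    then show ?thesis
      unfolding as by (simp add: merge_append list_update_append nth_append)
  next
    case 3
    then show ?thesis
      unfolding as by (simp add: merge_append list_update_append nth_append)
  next
    case 4
    then obtain k where "j = Suc (Suc (length us)) + k"
      using le_Suc_ex by blast
    then show ?thesis
      unfolding as by (simp add: merge_append list_update_append nth_append)
  qed
qed

text \<open>
  A face moves an entry into the coefficient through a generator of \<^const>\<open>UA\<close>, or it applies a
  linear map to the entry.
\<close>

lemma basis_face_entry:
  assumes "corepresentation N act" "x \<in> carrier N" "length as = n" "0 < n" "i \<le> n" "j < n"
  shows "(\<exists>g cs. length cs = n - 1 \<and>
      (\<forall>w. basis_face act n i (\<psi>, x, as[j := w]) = (delete_leaf i \<psi>, act x (env_gen g w), cs)))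
   \<or> (\<exists>r cs k L. length cs = n - 1 \<and> k < n - 1 \<and> r \<in> carrier UA \<and> (\<forall>u v. L (u + v) = L u + L v) \<and>
      (\<forall>c u. L (scale c u) = scale c (L u)) \<and>
      (\<forall>w. basis_face act n i (\<psi>, x, as[j := w]) = (delete_leaf i \<psi>, act x r, cs[k := L w])))"
proof -
  interpret N: right_module UA N act by fact
  consider "i = 0" "j = 0" | "i = 0" "0 < j" | "i = n" "j = n - 1" | "i = n" "j < n - 1" | "0 < i" "i < n"
    using assms by (cases "i = 0"; cases "j = 0"; cases "i = n"; cases "j = n - 1") auto
  then show ?thesis
  proof cases
    case 1
    then show ?thesis
      using assms by (intro disjI1 exI[of _ "first_index \<psi>"] exI[of _ "tl as"])
        (cases as; simp add: basis_face_simps)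
  next
    case 2
    then obtain a cs k where as: "as = a # cs" "j = Suc k"
      using assms by (cases as; cases j) auto
    then have "hd (as[j := w]) = hd as" "tl (as[j := w]) = (tl as)[j - 1 := w]" for w
      by simp_all
    then show ?thesis
      using 2 assms by (intro disjI2 exI[of _ "env_gen (first_index \<psi>) (hd as)"] exI[of _ "tl as"]
          exI[of _ "j - 1"] exI[of _ id]) (simp add: basis_face_simps)
  next
    case 3
    obtain cs c where as: "as = cs @ [c]" "length cs = n - 1"
      using assms by (cases as rule: rev_cases) auto
    then have "j = length cs"
      using 3 by simp
    then have "last (as[j := w]) = w" "butlast (as[j := w]) = butlast as" for w
      by (simp_all add: as(1))
    then show ?thesis
      using 3 assms by (intro disjI1 exI[of _ "last_index \<psi>"] exI[of _ "butlast as"])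
        (simp add: basis_face_simps)
  next
    case 4
    obtain cs c where as: "as = cs @ [c]" "length cs = n - 1"
      using assms by (cases as rule: rev_cases) auto
    then have "last (as[j := w]) = last as" "butlast (as[j := w]) = (butlast as)[j := w]" for w
      using 4 by (simp_all add: list_update_append)
    then show ?thesis
      using 4 assms by (intro disjI2 exI[of _ "env_gen (last_index \<psi>) (last as)"] exI[of _ "butlast as"]
          exI[of _ j] exI[of _ id]) (simp add: basis_face_simps)
  next
    case 5
    let ?f = "leaf_op i \<psi>"
    \<comment> \<open>An entry away from the contraction is kept, possibly at a shifted position. A
      contracted entry is multiplied by its fixed neighbour, which is linear because the operations
      are bilinear.\<close>
    obtain k L where "k < n - 1" and L: "L \<in> {id, \<lambda>w. ?f w (as ! i), ?f (as ! (i - 1))}"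
      and upd: "\<And>w. merge i ?f (as[j := w]) = (merge i ?f as)[k := L w]"
    proof -
      consider "j = i - 1" | "j = i" | "j < i - 1" | "i < j" by linarith
      then show thesis
      proof cases
        case 1
        then show thesis
          using 5 assms by (intro that[of "i - 1" "\<lambda>w. ?f w (as ! i)"]) (auto simp: merge_update)
      next
        case 2
        then show thesis
          using 5 assms by (intro that[of "i - 1" "?f (as ! (i - 1))"]) (auto simp: merge_update)
      next
        case 3
        then show thesis
          using 5 assms by (intro that[of j id]) (auto simp: merge_update)
      next
        case 4
        then show thesis
          using 5 assms by (intro that[of "j - 1" id]) (auto simp: merge_update)
      qed
    qed
    have "L (u + v) = L u + L v" "L (scale c u) = scale c (L u)" for u v c
      using L by (auto simp: leaf_op_orient orient_op_add orient_op_scale)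
    then show ?thesis
      using 5 assms \<open>k < n - 1\<close>
      by (intro disjI2 exI[of _ "\<one>\<^bsub>UA\<^esub>"] exI[of _ "merge i ?f as"] exI[of _ k] exI[of _ L])
        (simp add: basis_face_simps length_merge N.act_one upd)
  qed
qed

text \<open>Generators go to generators. The kind is preserved, except that a relation in an entry
  absorbed by an end face becomes the corresponding relation in the coefficient.\<close>

lemma basis_face_generator:
  assumes "corepresentation N act" "0 < n" "i \<le> n" "p \<in> chain_generators N act n"
  shows "linear_extension (basis_face act n i) p \<in> chain_relations N act (n - 1)"
proof -
  interpret N: right_module UA N act by fact
  let ?d = "linear_extension (basis_face act n i)" and ?\<Phi> = "delete_leaf i"
  have vec: "?d (basis_vec \<psi> x as) = Poly_Mapping.single (basis_face act n i (\<psi>, x, as)) 1" for \<psi> x as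
    by (simp add: basis_vec_def)
  note d = linear_extension_diff linear_extension_add linear_extension_pm_scale vec
  have \<Phi>: "?\<Phi> \<psi> \<in> trees (n - 1)" if "\<psi> \<in> trees n" for \<psi>
    using delete_leaf_trees[OF that] assms by simp
  \<comment> \<open>Centrality moves the scalar to the outermost position, where the relations for
    scalars apply.\<close>
  have swap: "act (act x (env_scalar c)) r = act (act x r) (env_scalar c)"
    if "x \<in> carrier N" "r \<in> carrier UA" for x c r
    using that by (simp add: env_scalar_central flip: N.act_mult)
  from assms(4) consider
    (add_coefficient) \<psi> x y as where "\<psi> \<in> trees n" "x \<in> carrier N" "y \<in> carrier N" "length as = n"
      "p = basis_vec \<psi> (x \<oplus>\<^bsub>N\<^esub> y) as - (basis_vec \<psi> x as + basis_vec \<psi> y as)"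
  | (scale_coefficient) \<psi> x c as where "\<psi> \<in> trees n" "x \<in> carrier N" "length as = n"
      "p = basis_vec \<psi> (act x (env_scalar c)) as - pm_scale c (basis_vec \<psi> x as)"
  | (add_entry) \<psi> x as j u v where "\<psi> \<in> trees n" "x \<in> carrier N" "length as = n" "j < n"
      "p = basis_vec \<psi> x (as[j := u + v]) - (basis_vec \<psi> x (as[j := u]) + basis_vec \<psi> x (as[j := v]))"
  | (scale_entry) \<psi> x as j c u where "\<psi> \<in> trees n" "x \<in> carrier N" "length as = n" "j < n"
      "p = basis_vec \<psi> x (as[j := scale c u]) - pm_scale c (basis_vec \<psi> x (as[j := u]))"
    unfolding chain_generators_def by (elim UnE CollectE exE conjE) (rule that; assumption)+
  then show ?thesis
  proof cases
    case add_coefficient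
    obtain r cs where r: "r \<in> carrier UA" "length cs = n - 1"
      "\<And>x. x \<in> carrier N \<Longrightarrow> basis_face act n i (\<psi>, x, as) = (?\<Phi> \<psi>, act x r, cs)"
      by (rule basis_face_coefficient[OF assms(1) add_coefficient(1,4) assms(2,3)]) blast
    have "?d p = basis_vec (?\<Phi> \<psi>) (act x r \<oplus>\<^bsub>N\<^esub> act y r) cs
        - (basis_vec (?\<Phi> \<psi>) (act x r) cs + basis_vec (?\<Phi> \<psi>) (act y r) cs)"
      using add_coefficient r(1) by (simp add: d r(3) N.act_add_left basis_vec_def)
    then show ?thesis
      using add_coefficient r \<Phi> by (simp add: relation_add_coefficient N.act_closed)
  next
    case scale_coefficient
    obtain r cs where r: "r \<in> carrier UA" "length cs = n - 1"
      "\<And>x. x \<in> carrier N \<Longrightarrow> basis_face act n i (\<psi>, x, as) = (?\<Phi> \<psi>, act x r, cs)"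
      by (rule basis_face_coefficient[OF assms(1) scale_coefficient(1,3) assms(2,3)]) blast
    have "?d p = basis_vec (?\<Phi> \<psi>) (act (act x r) (env_scalar c)) cs
        - pm_scale c (basis_vec (?\<Phi> \<psi>) (act x r) cs)"
      using scale_coefficient r(1) by (simp add: d r(3) swap N.act_closed basis_vec_def)
    then show ?thesis
      using scale_coefficient r \<Phi> by (simp only: relation_scale_coefficient N.act_closed)
  next
    case add_entry
    from basis_face_entry[OF assms(1) add_entry(2,3) assms(2,3) add_entry(4), of \<psi>]
    show ?thesis
    proof (elim disjE exE conjE)
      fix g cs assume *: "length cs = n - 1"
        "\<forall>w. basis_face act n i (\<psi>, x, as[j := w]) = (?\<Phi> \<psi>, act x (env_gen g w), cs)"
      have "?d p = basis_vec (?\<Phi> \<psi>) (act x (env_gen g u) \<oplus>\<^bsub>N\<^esub> act x (env_gen g v)) cs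
        - (basis_vec (?\<Phi> \<psi>) (act x (env_gen g u)) cs + basis_vec (?\<Phi> \<psi>) (act x (env_gen g v)) cs)"
        using add_entry * by (simp add: d N.act_add_right env_gen_add basis_vec_def)
      then show ?thesis
        using add_entry * \<Phi> by (simp add: relation_add_coefficient N.act_closed)
    next
      fix r cs k L assume *: "length cs = n - 1" "k < n - 1" "r \<in> carrier UA" "\<forall>u v. L (u + v) = L u + L v"
        "\<forall>w. basis_face act n i (\<psi>, x, as[j := w]) = (?\<Phi> \<psi>, act x r, cs[k := L w])"
      have "?d p = basis_vec (?\<Phi> \<psi>) (act x r) (cs[k := L u + L v])
        - (basis_vec (?\<Phi> \<psi>) (act x r) (cs[k := L u]) + basis_vec (?\<Phi> \<psi>) (act x r) (cs[k := L v]))"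
        using add_entry * by (simp add: d basis_vec_def)
      then show ?thesis
        using add_entry * \<Phi> by (simp add: relation_add_entry N.act_closed)
    qed
  next
    case scale_entry
    from basis_face_entry[OF assms(1) scale_entry(2,3) assms(2,3) scale_entry(4), of \<psi>]
    show ?thesis
    proof (elim disjE exE conjE)
      fix g cs assume *: "length cs = n - 1"
        "\<forall>w. basis_face act n i (\<psi>, x, as[j := w]) = (?\<Phi> \<psi>, act x (env_gen g w), cs)"
      have "?d p = basis_vec (?\<Phi> \<psi>) (act (act x (env_gen g u)) (env_scalar c)) cs
        - pm_scale c (basis_vec (?\<Phi> \<psi>) (act x (env_gen g u)) cs)"
        using scale_entry * by (simp add: d N.act_mult env_gen_scale basis_vec_def)
      then show ?thesis
        using scale_entry * \<Phi> by (simp only: relation_scale_coefficient N.act_closed env_gen_closed)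
    next
      fix r cs k L assume *: "length cs = n - 1" "k < n - 1" "r \<in> carrier UA"
        "\<forall>c u. L (scale c u) = scale c (L u)"
        "\<forall>w. basis_face act n i (\<psi>, x, as[j := w]) = (?\<Phi> \<psi>, act x r, cs[k := L w])"
      have "?d p = basis_vec (?\<Phi> \<psi>) (act x r) (cs[k := scale c (L u)])
        - pm_scale c (basis_vec (?\<Phi> \<psi>) (act x r) (cs[k := L u]))"
        using scale_entry * by (simp add: d basis_vec_def)
      then show ?thesis
        using scale_entry * \<Phi> by (simp only: relation_scale_entry N.act_closed)
    qed
  qed
qed

lemma face_relations:
  assumes "corepresentation N act" "0 < n" "i \<le> n" "p \<in> chain_relations N act n"
  shows "linear_extension (basis_face act n i) p \<in> chain_relations N act (n - 1)"
  using linear_extension_generated_submodule[OF chain_relations_submodule[OF assms(1)]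
      chain_generators_subset[OF assms(1)] basis_face_generator[OF assms(1-3)]] assms(4)
  unfolding chain_relations_eq[of N act n] by blast

lemma face_closed:
  assumes "corepresentation N act" "0 < n" "i \<le> n" "Poly_Mapping.keys p \<subseteq> chain_basis N n"
  shows "Poly_Mapping.keys (linear_extension (basis_face act n i) p) \<subseteq> chain_basis N (n - 1)"
  using keys_linear_extension[of "basis_face act n i" p] basis_face_closed[OF assms(1) _ assms(2,3)] assms(4)
  by blast

section \<open>Faces and differential on classes\<close>

abbreviation chain_class where
  "chain_class N act n p \<equiv> chain_relations N act n +>\<^bsub>free_module (chain_basis N n)\<^esub> p"

text \<open>The union in \<open>trias_face\<close> runs over all representatives. Two of them differ
  by a relation, which \<open>face_relations\<close> sends to a relation, so the union consists of
  one and the same coset.\<close>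

lemma trias_face_class:
  assumes "corepresentation N act" "0 < n" "i \<le> n" "Poly_Mapping.keys p \<subseteq> chain_basis N n"
  shows "trias_face N act n i (chain_class N act n p) =
    chain_class N act (n - 1) (linear_extension (basis_face act n i) p)"
proof -
  let ?d = "linear_extension (basis_face act n i)"
  interpret M: module "ring_of_type_algebra :: 'k ring" "free_module (chain_basis N n)"
    by (rule free_module_module)
  interpret M': module "ring_of_type_algebra :: 'k ring" "free_module (chain_basis N (n - 1))"
    by (rule free_module_module)
  interpret U: abelian_subgroup "chain_relations N act n" "free_module (chain_basis N n)"
    by (rule M.abelian_subgroup_submodule[OF chain_relations_submodule[OF assms(1)]])
  have "chain_class N act (n - 1) (?d q) = chain_class N act (n - 1) (?d p)"
    if q: "q \<in> chain_class N act n p" for q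
  proof -
    obtain u where u: "u \<in> chain_relations N act n" "q = u + p"
      using q by (auto simp: a_r_coset_def')
    then show ?thesis
      using M'.coset_add_absorb[OF chain_relations_submodule[OF assms(1)] face_relations[OF assms(1-3) u(1)],
          of "?d p"] face_closed[OF assms]
      by (simp add: linear_extension_add)
  qed
  then have "trias_face N act n i (chain_class N act n p) =
      (\<Union>q\<in>chain_class N act n p. chain_class N act (n - 1) (?d p))"
    unfolding trias_face_def chain_free_eq by (rule SUP_cong[OF refl])
  also have "\<dots> = chain_class N act (n - 1) (?d p)"
    using U.a_rcos_self[of p] assms(4) by auto
  finally show ?thesis .
qed

text \<open>A lift of the differential to the free modules. It squares to zero already there, so no
  relation of the tensor product enters the computation.\<close>

definition free_differential ::
    "('n \<Rightarrow> ('a, 'k) env_elem \<Rightarrow> 'n) \<Rightarrow> nat \<Rightarrow>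
     (('a, 'n) tensor_basis \<Rightarrow>\<^sub>0 'k) \<Rightarrow> (('a, 'n) tensor_basis \<Rightarrow>\<^sub>0 'k)" where
  "free_differential act n p =
    (\<Sum>i\<le>n. pm_scale ((-1) ^ i) (linear_extension (basis_face act n i) p))"

lemma free_differential_closed:
  assumes "corepresentation N act" "0 < n" "Poly_Mapping.keys p \<subseteq> chain_basis N n"
  shows "Poly_Mapping.keys (free_differential act n p) \<subseteq> chain_basis N (n - 1)"
  using keys_sum[of "\<lambda>i. pm_scale ((-1) ^ i) (linear_extension (basis_face act n i) p)" "{..n}"]
    keys_pm_scale face_closed[OF assms(1,2) _ assms(3)]
  unfolding free_differential_def by fastforce

lemma trias_differential_class:
  assumes "corepresentation N act" "0 < n" "Poly_Mapping.keys p \<subseteq> chain_basis N n"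
  shows "trias_differential N act n (chain_class N act n p) =
    chain_class N act (n - 1) (free_differential act n p)"
proof -
  let ?B = "chain_basis N (n - 1)" and ?U = "chain_relations N act (n - 1)"
  let ?d = "\<lambda>i. linear_extension (basis_face act n i) p"
  interpret M: module "ring_of_type_algebra :: 'k ring" "free_module ?B"
    by (rule free_module_module)
  note U = chain_relations_submodule[OF assms(1), of "n - 1"]
  interpret Q: module "ring_of_type_algebra :: 'k ring" "quotient_module (free_module ?B) ?U"
    by (rule M.quotient_module_module[OF U])
  have closed: "?d i \<in> carrier (free_module ?B)" if "i \<le> n" for i
    using face_closed[OF assms(1,2) that assms(3)] by simp
  then have closed': "Poly_Mapping.keys (pm_scale ((-1) ^ i) (?d i)) \<subseteq> ?B" if "i \<le> n" for i
    using that keys_pm_scale[of "(-1) ^ i" "?d i"] by fastforce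
  have face: "((-1) ^ i) \<odot>\<^bsub>quotient_module (free_module ?B) ?U\<^esub> trias_face N act n i (chain_class N act n p)
      = chain_class N act (n - 1) (pm_scale ((-1) ^ i) (?d i))" if "i \<le> n" for i
    using M.quotient_smult[OF U _ closed[OF that]] trias_face_class[OF assms(1,2) that assms(3)] by simp
  have "trias_differential N act n (chain_class N act n p) =
      (\<Oplus>\<^bsub>quotient_module (free_module ?B) ?U\<^esub>i\<in>{..n}. chain_class N act (n - 1) (pm_scale ((-1) ^ i) (?d i)))"
    unfolding trias_differential_def trias_chains_def chain_free_eq
  proof (rule Q.M.finsum_cong'[OF refl])
    show "(\<lambda>i. chain_class N act (n - 1) (pm_scale ((-1) ^ i) (?d i)))
        \<in> {..n} \<rightarrow> carrier (quotient_module (free_module ?B) ?U)"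
      unfolding M.quotient_carrier[OF U] using closed' by (intro Pi_I imageI) simp
  qed (rule face, simp)
  also have "\<dots> = chain_class N act (n - 1) (\<Oplus>\<^bsub>free_module ?B\<^esub>i\<in>{..n}. pm_scale ((-1) ^ i) (?d i))"
    using closed' by (intro M.quotient_finsum[OF U]) auto
  also have "(\<Oplus>\<^bsub>free_module ?B\<^esub>i\<in>{..n}. pm_scale ((-1) ^ i) (?d i)) = free_differential act n p"
    unfolding free_differential_def using closed' by (intro finsum_free_module) auto
  finally show ?thesis .
qed

lemma free_differential_add:
  "free_differential act n (p + q) = free_differential act n p + free_differential act n q"
  by (simp add: free_differential_def linear_extension_add pm_scale_add sum.distrib)

lemma free_differential_pm_scale:
  "free_differential act n (pm_scale c p) = pm_scale c (free_differential act n p)"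
  by (simp add: free_differential_def linear_extension_pm_scale pm_scale_sum mult.commute)

text \<open>A composite of linear extensions is the linear extension of the composite, so the values
  on the basis decide, and \<open>basis_face_commute\<close> supplies the pairing of terms.\<close>

lemma free_differential_free_differential:
  assumes "corepresentation N act" "1 < n" "Poly_Mapping.keys p \<subseteq> chain_basis N n"
  shows "free_differential act (n - 1) (free_differential act n p) = 0"
proof -
  define F where "F i j = linear_extension (basis_face act (n - 1) i \<circ> basis_face act n j) p" for i j
  have "F i j = F (j - 1) i" if "i < j" "j \<le> Suc (n - 1)" for i j
    unfolding F_def using that assms(2,3) basis_face_commute[OF assms(1)]
    by (intro linear_extension_cong) auto
  then have "(\<Sum>i\<le>n - 1. \<Sum>j\<le>Suc (n - 1). pm_scale ((-1) ^ (i + j)) (F i j)) = 0"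
    by (rule sum_sum_alternating_eq_0)
  then show ?thesis
    using assms(2) by (simp add: free_differential_def linear_extension_sum linear_extension_pm_scale
        linear_extension_linear_extension pm_scale_sum power_add F_def)
qed

text \<open>Every chain is the class of an element supported on \<open>chain_basis\<close>, so each
  condition is pulled back to \<open>free_differential\<close> on representatives.\<close>

theorem chain_complex_corepresentation:
  assumes "corepresentation N act"
  shows "chain_complex (ring_of_type_algebra :: 'k ring) (trias_chains N act) (trias_differential N act)"
proof -
  have chains: "trias_chains N act n = quotient_module (free_module (chain_basis N n)) (chain_relations N act n)" for n
    by (simp add: trias_chains_def chain_free_eq)
  interpret M: module "ring_of_type_algebra :: 'k ring" "free_module (chain_basis N n)" for n
    by (rule free_module_module)
  note U = chain_relations_submodule[OF assms]
  note closed = free_differential_closed[OF assms] and diff = trias_differential_class[OF assms]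
  have keys: "Poly_Mapping.keys (p + q) \<subseteq> B" "Poly_Mapping.keys (pm_scale c p) \<subseteq> B"
    if "Poly_Mapping.keys p \<subseteq> B" "Poly_Mapping.keys q \<subseteq> B"
    for p q :: "('a, 'b) tensor_basis \<Rightarrow>\<^sub>0 'k" and c B
    using that keys_add[of p q] keys_pm_scale[of c p] by blast+
  have cases: "\<exists>p. Y = chain_class N act n p \<and> Poly_Mapping.keys p \<subseteq> chain_basis N n"
    if "Y \<in> carrier (trias_chains N act n)" for Y n
    using that by (auto simp: chains M.quotient_carrier[OF U])
  show ?thesis
  proof (rule chain_complex.intro)
    fix n
    show "Module.module (ring_of_type_algebra :: 'k ring) (trias_chains N act n)"
      unfolding chains by (rule M.quotient_module_module[OF U])
  next
    fix n Y assume n: "1 \<le> n" and "Y \<in> carrier (trias_chains N act n)"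
    then obtain p where p: "Y = chain_class N act n p" "Poly_Mapping.keys p \<subseteq> chain_basis N n"
      using cases by blast
    then show "trias_differential N act n Y \<in> carrier (trias_chains N act (n - 1))"
      using n diff[of n p] closed[of n p] by (simp add: chains M.quotient_carrier[OF U])
  next
    fix n c Y assume n: "1 \<le> n" and "Y \<in> carrier (trias_chains N act n)"
    then obtain p where p: "Y = chain_class N act n p" "Poly_Mapping.keys p \<subseteq> chain_basis N n"
      using cases by blast
    show "trias_differential N act n (c \<odot>\<^bsub>trias_chains N act n\<^esub> Y) =
        c \<odot>\<^bsub>trias_chains N act (n - 1)\<^esub> trias_differential N act n Y"
      using n p diff[of n] closed[of n p] keys(2)[OF p(2) p(2), of c]
      by (simp add: chains M.quotient_smult[OF U] free_differential_pm_scale)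
  next
    fix n Y Z assume n: "1 \<le> n" and "Y \<in> carrier (trias_chains N act n)" "Z \<in> carrier (trias_chains N act n)"
    then obtain p q where p: "Y = chain_class N act n p" "Poly_Mapping.keys p \<subseteq> chain_basis N n"
      and q: "Z = chain_class N act n q" "Poly_Mapping.keys q \<subseteq> chain_basis N n"
      using cases by blast
    show "trias_differential N act n (Y \<oplus>\<^bsub>trias_chains N act n\<^esub> Z) =
        trias_differential N act n Y \<oplus>\<^bsub>trias_chains N act (n - 1)\<^esub> trias_differential N act n Z"
      using n p q diff[of n] closed[of n p] closed[of n q] keys(1)[OF p(2) q(2)]
      by (simp add: chains M.quotient_add[OF U] free_differential_add)
  next
    fix n Y assume n: "2 \<le> n" and "Y \<in> carrier (trias_chains N act n)"
    then obtain p where p: "Y = chain_class N act n p" "Poly_Mapping.keys p \<subseteq> chain_basis N n"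
      using cases by blast
    have "n - 1 - 1 = n - 2" by simp
    then have "trias_differential N act (n - 1) (trias_differential N act n Y) = chain_class N act (n - 2) 0"
      using n p diff[of n p] closed[of n p] diff[of "n - 1" "free_differential act n p"]
        free_differential_free_differential[OF assms, of n p] by simp
    then show "trias_differential N act (n - 1) (trias_differential N act n Y) = \<zero>\<^bsub>trias_chains N act (n - 2)\<^esub>"
      by (simp add: chains M.quotient_zero[OF U] del: M.a_coset_add_zero)
  qed
qed

end

theorem proposition3p8:
  fixes scale :: "'k::field \<Rightarrow> 'a::ab_group_add \<Rightarrow> 'a"
    and left right mid :: "'a \<Rightarrow> 'a \<Rightarrow> 'a"
  assumes "triassociative_algebra scale left right mid"
  shows "chain_complex (ring_of_type_algebra :: 'k ring)
    (triassociative_algebra.trias_chains scale left right mid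
       (triassociative_algebra.UA scale left right mid)
       (monoid.mult (triassociative_algebra.UA scale left right mid)))
    (triassociative_algebra.trias_differential scale left right mid
       (triassociative_algebra.UA scale left right mid)
       (monoid.mult (triassociative_algebra.UA scale left right mid)))"
proof -
  interpret triassociative_algebra scale left right mid
    by fact
  show ?thesis
    by (rule chain_complex_corepresentation[OF corepresentation_UA])
qed

end
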